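(* Let $\mathcal{H}\subseteq\Omega$ be a Banach space continuously embedded in $\Omega$. Let $\eta:\mathbb{R}\times\Omega\to\mathbb{R}$, $\xi:\Omega\to\mathbb{R}$, $f_0,f_1:[0,T]\times\mathbb{R}\times\Omega\to\mathbb{R}$ and $g_0,g_1:[0,T]\times\Omega\to\mathbb{R}$ be measurable functions such that: $f_0(s,x,\omega)$ and $g_0(s,\omega)$ are continuous in $s\in[0,T]$; $f_1(s,x,\omega)$ and $g_1(s,\omega)$ are Hölder continuous with respect to $s$ of order greater than $1-H$; $f_1(s,x,\omega)$ is Lipschitz in $x$. Define $$F(t,x,\omega)=\eta(x,\omega)+\int_0^tf_0(s,x,\omega)\,ds+\int_0^tf_1(s,x,\omega)\,\delta B(s),$$ $$G(t,\omega)=\xi(\omega)+\int_0^tg_0(s,\omega)\,ds+\int_0^tg_1(s,\omega)\,\delta B(s).$$ Assume that $F$ and $\frac{\partial}{\partial x}F(t,x,\omega)$ are Hölder continuous in $t$ of exponent greater than $1-H$, Lipschitz in $x$, and $\mathcal{H}$-differentiable in $\omega$. Let $h(t,u,\omega)$, $(t,u,\omega)\in[0,T]^2\times\Omega$, be continuous in $t$ and $u$, let $$\Gamma(t,\omega)=\omega+\int_0^\cdot h(t,u,\omega)\,du,\qquad t\in[0,T],$$ and assume that $\Gamma:[0,T]\times\Omega\to\Omega$ is continuously differentiable in $t$ with respect to the topology of $\mathcal{H}$ (namely, $\frac{d}{dt}\Gamma(t)\in\mathcal{H}$). Then, for $t\in[0,T]$ (suppressing $\omega$), $$\begin{aligned}F(t,G(t),\Gamma(t))={}&F(0,G(0),\Gamma(0))+\int_0^tf_0(s,G(s),\Gamma(s))\,ds+\int_0^tf_1(s,G(s),\Gamma(s))\,\delta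 B(s)\\&+\int_0^tf_1(s,G(s),\Gamma(s))\,h(s,s,\omega)\,ds+\int_0^t\frac{\partial F}{\partial x}(s,G(s),\Gamma(s))\,g_0(s)\,ds\\&+\int_0^t\frac{\partial F}{\partial x}(s,G(s),\Gamma(s))\,g_1(s)\,\delta B(s)+\int_0^t(\mathbb{D}F)(s,G(s),\Gamma(s))\frac{d}{ds}\Gamma(s)\,ds,\end{aligned}$$ where $(\mathbb{D}F)(s,G(s),\Gamma(s))\frac{d}{ds}\Gamma(s):=\mathbb{D}F(s,x,\omega')\big|_{x=G(s,\omega),\,\omega'=\Gamma(s,\omega)}\big(\frac{d}{ds}\Gamma(s,\omega)\big)$.
   Context: Fix $T\in(0,\infty)$ and $H\in(1/2,1)$. $\Omega$ is the space of continuous functions $[0,T]\to\mathbb{R}$ with the sup norm, $B(t)(\omega)=\omega(t)$, and $\mathbb{P}$ is the probability measure on $\Omega$ under which $B$ is a fractional Brownian motion of Hurst parameter $H$. One works on the full-measure subset of $\Omega$ (still denoted $\Omega$) on which $B(\cdot,\omega)$ is Hölder continuous of every exponent less than $H$. For $f$ whose paths are Hölder continuous of exponent greater than $1-H$, $\int_0^tf(s)\,\delta B(s)$ is the pathwise (Young/Riemann–Stieltjes) integral. A map $F$ from $\Omega$ to a Banach space $\mathbb{B}$ is $\mathcal{H}$-differentiable if for every $\omega$ there is a bounded linear map $\mathbb{D}F(\omega):\mathcal{H}\to\mathbb{B}$ with $\lim_{\varepsilon\to0}\varepsilon^{-1}(F(\omega+\varepsilon h)-F(\omega))=\mathbb{D}F(\omega)(h)$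 for all $h\in\mathcal{H}$. In $F(t,G(t),\Gamma(t))$ the third slot means that the random functional $F(t,x,\cdot)$ (including the path $B$ in its definition) is evaluated at the path $\Gamma(t,\omega)$; likewise for $f_0,f_1,\partial_xF$. The integrals $\int\cdots\delta B(s)$ in the conclusion are with respect to the original path $B(s)=\omega(s)$.
   Formalization: Two assumptions are added: the limit defining DF(t,x,ω)(k) is uniform for t in [0,T] and x, k in compact sets (with the directional limit alone the formula can fail), and all integrals on the right-hand side except the last, whose existence is proved, are assumed to exist. *)

theory Defs
  imports "HOL-Probability.Probability"
begin

definition holder_on :: "real \<Rightarrow> real set \<Rightarrow> (real \<Rightarrow> real) \<Rightarrow> bool" where
  "holder_on \<alpha> S f \<longleftrightarrow>
     (\<exists>C. \<forall>s\<in>S. \<forall>t\<in>S. \<bar>f s - f t\<bar> \<le> C * \<bar>s - t\<bar> powr \<alpha>)"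

subsection \<open>Path space\<close>

text \<open>A continuous path on \<open>[0,T]\<close> is represented by its extension to the real line that is
  constant on either side of \<open>[0,T]\<close>. This identifies \<open>C([0,T])\<close> isometrically with a closed
  subspace of the bounded continuous functions with the sup norm.\<close>

type_synonym path = "real \<Rightarrow>\<^sub>C real"

definition paths :: "real \<Rightarrow> path set" where
  "paths T = {\<omega>. \<forall>s. apply_bcontfun \<omega> s = apply_bcontfun \<omega> (max 0 (min T s))}"

definition holder_paths :: "real \<Rightarrow> real \<Rightarrow> path set" where
  "holder_paths T H =
     {\<omega> \<in> paths T. \<forall>\<beta>. 0 < \<beta> \<and> \<beta> < H \<longrightarrow> holder_on \<beta> {0..T} (apply_bcontfun \<omega>)}"

subsection \<open>Fractional Brownian motion\<close>

text \<open>Degenerate (almost surely constant) variables count as Gaussian.\<close>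

definition gaussian_rv :: "'a measure \<Rightarrow> ('a \<Rightarrow> real) \<Rightarrow> bool" where
  "gaussian_rv P X \<longleftrightarrow>
     (\<exists>\<mu>. AE \<omega> in P. X \<omega> = \<mu>) \<or>
     (\<exists>\<mu> \<sigma>. 0 < \<sigma> \<and> distributed P lborel X (normal_density \<mu> \<sigma>))"

text \<open>The law on path space under which the coordinate process is a centred Gaussian process with
  the covariance of fractional Brownian motion.\<close>

definition fbm_law :: "real \<Rightarrow> real \<Rightarrow> path measure \<Rightarrow> bool" where
  "fbm_law T H P \<longleftrightarrow>
     prob_space P \<and> sets P = sets (restrict_space borel (paths T)) \<and>
     (\<forall>I c. finite I \<and> I \<subseteq> {0..T} \<longrightarrow> gaussian_rv P (\<lambda>\<omega>. \<Sum>s\<in>I. c s * apply_bcontfun \<omega> s)) \<and>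
     (\<forall>s\<in>{0..T}. (LINT \<omega>|P. apply_bcontfun \<omega> s) = 0) \<and>
     (\<forall>s\<in>{0..T}. \<forall>t\<in>{0..T}. (LINT \<omega>|P. apply_bcontfun \<omega> s * apply_bcontfun \<omega> t)
        = (s powr (2 * H) + t powr (2 * H) - \<bar>t - s\<bar> powr (2 * H)) / 2)"

subsection \<open>Riemann--Stieltjes integral\<close>

text \<open>Limit of tagged Riemann--Stieltjes sums as the mesh tends to zero. The constant-radius gauge
  \<open>\<lambda>x. ball x d\<close> bounds the mesh; for a cell \<open>K = [u,v]\<close> the increment of \<open>g\<close> is \<open>g v - g u\<close>.\<close>

definition has_rs_integral ::
    "(real \<Rightarrow> real) \<Rightarrow> (real \<Rightarrow> real) \<Rightarrow> real \<Rightarrow> real \<Rightarrow> real \<Rightarrow> bool" where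
  "has_rs_integral f g a b I \<longleftrightarrow>
     (\<forall>e>0. \<exists>d>0. \<forall>p. p tagged_division_of {a..b} \<and> (\<lambda>x. ball x d) fine p \<longrightarrow>
        \<bar>(\<Sum>(x, K)\<in>p. f x * (g (Sup K) - g (Inf K))) - I\<bar> < e)"

definition rs_integrable :: "(real \<Rightarrow> real) \<Rightarrow> (real \<Rightarrow> real) \<Rightarrow> real \<Rightarrow> real \<Rightarrow> bool" where
  "rs_integrable f g a b \<longleftrightarrow> (\<exists>I. has_rs_integral f g a b I)"

definition rs_integral :: "(real \<Rightarrow> real) \<Rightarrow> (real \<Rightarrow> real) \<Rightarrow> real \<Rightarrow> real \<Rightarrow> real" where
  "rs_integral f g a b = (THE I. has_rs_integral f g a b I)"

lemma has_rs_integral_unique: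
  assumes "has_rs_integral f g a b I" "has_rs_integral f g a b J"
  shows "I = J"
proof (rule ccontr)
  assume "I \<noteq> J"
  then have e: "\<bar>I - J\<bar> / 2 > 0" by simp
  obtain d1 where d1: "d1 > 0"
    "\<And>p. p tagged_division_of {a..b} \<Longrightarrow> (\<lambda>x. ball x d1) fine p \<Longrightarrow>
        \<bar>(\<Sum>(x, K)\<in>p. f x * (g (Sup K) - g (Inf K))) - I\<bar> < \<bar>I - J\<bar> / 2"
    using assms(1)[unfolded has_rs_integral_def, rule_format, OF e] by blast
  obtain d2 where d2: "d2 > 0"
    "\<And>p. p tagged_division_of {a..b} \<Longrightarrow> (\<lambda>x. ball x d2) fine p \<Longrightarrow>
        \<bar>(\<Sum>(x, K)\<in>p. f x * (g (Sup K) - g (Inf K))) - J\<bar> < \<bar>I - J\<bar> / 2"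
    using assms(2)[unfolded has_rs_integral_def, rule_format, OF e] by blast
  have "gauge (\<lambda>x::real. ball x (min d1 d2))"
    using d1(1) d2(1) by (auto simp: gauge_def)
  then obtain p where p: "p tagged_division_of {a..b}" "(\<lambda>x. ball x (min d1 d2)) fine p"
    using fine_division_exists_real by blast
  have fine: "(\<lambda>x. ball x d1) fine p" "(\<lambda>x. ball x d2) fine p"
    using p(2) unfolding fine_def by fastforce+
  have "False" if "\<bar>S - I\<bar> < \<bar>I - J\<bar> / 2" "\<bar>S - J\<bar> < \<bar>I - J\<bar> / 2" for S
    using that by (simp add: abs_if field_simps split: if_splits)
  then show False
    using d1(2)[OF p(1) fine(1)] d2(2)[OF p(1) fine(2)] by blast
qed

subsection \<open>Differentiation along a continuously embedded Banach space\<close>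

text \<open>The Banach space \<open>\<H>\<close> is a type \<open>'h\<close> together with an injective bounded linear
  map \<open>j\<close> into the path space.\<close>

definition has_H_derivative ::
    "('h::banach \<Rightarrow>\<^sub>L path) \<Rightarrow> (path \<Rightarrow> 'b::banach) \<Rightarrow> ('h \<Rightarrow>\<^sub>L 'b) \<Rightarrow> path \<Rightarrow> bool" where
  "has_H_derivative j F F' \<omega> \<longleftrightarrow>
     (\<forall>k. ((\<lambda>\<epsilon>. (F (\<omega> + \<epsilon> *\<^sub>R blinfun_apply j k) - F \<omega>) /\<^sub>R \<epsilon>)
             \<longlongrightarrow> blinfun_apply F' k) (at 0))"

definition H_differentiable_on ::
    "('h::banach \<Rightarrow>\<^sub>L path) \<Rightarrow> path set \<Rightarrow> (path \<Rightarrow> 'b::banach) \<Rightarrow> bool" where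
  "H_differentiable_on j \<Omega> F \<longleftrightarrow> (\<forall>\<omega>\<in>\<Omega>. \<exists>F'. has_H_derivative j F F' \<omega>)"

text \<open>Differentiability of a path-valued curve in the topology of \<open>\<H>\<close>: its increments lie in
  \<open>\<H>\<close>, and the difference quotients converge in the norm of \<open>\<H>\<close>.\<close>

definition has_H_curve_derivative ::
    "('h::banach \<Rightarrow>\<^sub>L path) \<Rightarrow> (real \<Rightarrow> path) \<Rightarrow> 'h \<Rightarrow> real \<Rightarrow> real set \<Rightarrow> bool" where
  "has_H_curve_derivative j c v t S \<longleftrightarrow>
     (\<forall>s\<in>S. c s - c t \<in> range (blinfun_apply j)) \<and>
     ((\<lambda>s. inv (blinfun_apply j) (c s - c t) /\<^sub>R (s - t)) \<longlongrightarrow> v) (at t within S)"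

text \<open>Directional limits alone give no chain rule along curves: the function
  \<open>x\<^sup>3 y / (x\<^sup>6 + y\<^sup>2)\<close> (value \<open>0\<close> at the origin) has a linear directional derivative
  everywhere, but equals \<open>1/2\<close> on the curve \<open>y = x\<^sup>3\<close> away from the origin. The following
  condition asks that the limit defining the derivative of \<open>F(t,x,\<cdot>)\<close> is uniform for
  \<open>t \<in> [0,T]\<close> and for \<open>x\<close> and the direction \<open>k\<close> in compact sets.\<close>

definition H_derivative_locally_uniform ::
    "('h::banach \<Rightarrow>\<^sub>L path) \<Rightarrow> real \<Rightarrow> (real \<Rightarrow> real \<Rightarrow> path \<Rightarrow> real)
       \<Rightarrow> (real \<Rightarrow> real \<Rightarrow> path \<Rightarrow> 'h \<Rightarrow>\<^sub>L real) \<Rightarrow> path \<Rightarrow> bool" where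
  "H_derivative_locally_uniform j T F F' \<omega> \<longleftrightarrow>
     (\<forall>X K. compact X \<and> compact K \<longrightarrow>
        uniform_limit ({0..T} \<times> X \<times> K)
          (\<lambda>\<epsilon> (t, x, k). (F t x (\<omega> + \<epsilon> *\<^sub>R blinfun_apply j k) - F t x \<omega>) / \<epsilon>)
          (\<lambda>(t, x, k). blinfun_apply (F' t x \<omega>) k) (at 0))"

end

theory Submission
  imports Defs "HOL-Library.Landau_Symbols"
begin

text \<open>Put \<open>\<Phi>(v) = F(v, G(v), \<Gamma>(v))\<close>. At each fixed \<open>s\<close> one shows
  \<open>\<Phi>(v) - \<Phi>(s) = A(s) (v - s) + M(s) (B(v) - B(s)) + o(v - s)\<close>, where \<open>A\<close> collects the \<open>ds\<close>
  integrands and \<open>M\<close> the \<open>\<delta>B\<close> integrands: the path variable is moved first (differentiability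
  along \<open>\<H>\<close>), then the space variable (Taylor, with \<open>G\<close> Hoelder continuous of exponent greater
  than \<open>1/2\<close>), then time, where the Young estimate applies to the integrals driven by the frozen path
  \<open>\<Gamma>(s)\<close>; the increment of that path exceeds the increment of \<open>B\<close> by \<open>h(s,s) (v - s) + o(v - s)\<close>.
  The rate in \<open>o(v - s)\<close> depends on \<open>s\<close>, since the Hoelder constants of \<open>f\<^sub>1(\<cdot>, x, \<omega>)\<close> depend on
  \<open>(x, \<omega>)\<close>; a Henstock--Kurzweil gauge depending on the tag \<open>s\<close> still allows one to sum the
  increments, and existence of the other integrals yields existence of the last one. The Young
  estimate itself is the sewing lemma, obtained from limits of dyadic sums.\<close>

section \<open>Additive functionals close to a germ\<close>

text \<open>The sum of the germ \<open>X\<close> over the \<open>2 ^ n\<close> equal cells of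
  \<open>[u, v]\<close>. Splitting at the outermost midpoint, rather than refining the smallest
  cells, reduces level \<open>n + 1\<close> on \<open>[u, v]\<close> to level \<open>n\<close> on
  its two halves.\<close>

primrec dyadic_sum :: "(real \<Rightarrow> real \<Rightarrow> real) \<Rightarrow> nat \<Rightarrow> real \<Rightarrow> real \<Rightarrow> real" where
  "dyadic_sum X 0 u v = X u v"
| "dyadic_sum X (Suc n) u v = dyadic_sum X n u ((u + v) / 2) + dyadic_sum X n ((u + v) / 2) v"

lemma midpoint_powr:
  fixes u v \<theta> :: real
  assumes "u \<le> v"
  shows "((u + v) / 2 - u) powr \<theta> + (v - (u + v) / 2) powr \<theta> = 2 powr (1 - \<theta>) * (v - u) powr \<theta>"
proof -
  have e: "(u + v) / 2 - u = (v - u) / 2" "v - (u + v) / 2 = (v - u) / 2"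
    by (simp_all add: field_simps)
  show ?thesis
    using assms by (simp add: e powr_divide powr_diff)
qed

text \<open>Each half carries \<open>2 powr (- \<theta>)\<close> of the bound, so one halving costs
  the factor \<open>2 powr (1 - \<theta>)\<close>, which is below 1 for \<open>\<theta> > 1\<close>.
  With \<open>D\<close> and \<open>E\<close> consecutive defects this gives convergence of dyadic
  sums; with \<open>D = E\<close> it gives uniqueness.\<close>

lemma dyadic_step:
  fixes D E :: "real \<Rightarrow> real \<Rightarrow> real"
  assumes "\<And>u v. u \<le> v \<Longrightarrow> \<bar>D u v\<bar> \<le> c * (v - u) powr \<theta>"
    and "\<And>u v. u \<le> v \<Longrightarrow> E u v = D u ((u + v) / 2) + D ((u + v) / 2) v"
    and "u \<le> v"
  shows "\<bar>E u v\<bar> \<le> c * 2 powr (1 - \<theta>) * (v - u) powr \<theta>"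
proof -
  have "\<bar>E u v\<bar> \<le> \<bar>D u ((u + v) / 2)\<bar> + \<bar>D ((u + v) / 2) v\<bar>"
    using assms by simp
  also have "\<dots> \<le> c * ((u + v) / 2 - u) powr \<theta> + c * (v - (u + v) / 2) powr \<theta>"
    using assms by (intro add_mono assms(1)) auto
  also have "\<dots> = c * 2 powr (1 - \<theta>) * (v - u) powr \<theta>"
    using midpoint_powr[OF assms(3), of \<theta>] by (simp flip: distrib_left)
  finally show ?thesis .
qed

text \<open>At level 0 the difference is the additivity defect of \<open>X\<close> at the midpoint;
  every further level gains one factor from \<open>dyadic_step\<close>.\<close>

lemma dyadic_sum_diff:
  assumes "\<And>u m v. u \<le> m \<Longrightarrow> m \<le> v \<Longrightarrow> \<bar>X u v - X u m - X m v\<bar> \<le> C * (v - u) powr \<theta>"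
    and "u \<le> v"
  shows "\<bar>dyadic_sum X (Suc n) u v - dyadic_sum X n u v\<bar>
           \<le> C * (2 powr (1 - \<theta>)) ^ n * (v - u) powr \<theta>"
  using assms(2)
proof (induction n arbitrary: u v)
  case 0
  then show ?case
    using assms(1)[of u "(u + v) / 2" v] by (simp add: abs_minus_commute algebra_simps)
next
  case (Suc n)
  have "\<bar>(dyadic_sum X (Suc (Suc n)) u v - dyadic_sum X (Suc n) u v)\<bar>
      \<le> C * (2 powr (1 - \<theta>)) ^ n * 2 powr (1 - \<theta>) * (v - u) powr \<theta>"
    by (rule dyadic_step[where D = "\<lambda>u v. dyadic_sum X (Suc n) u v - dyadic_sum X n u v"
          and E = "\<lambda>u v. dyadic_sum X (Suc (Suc n)) u v - dyadic_sum X (Suc n) u v",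
          OF Suc.IH _ Suc.prems])
      auto
  then show ?case by (simp add: mult_ac)
qed

text \<open>Midpoint additivity lets the bound on \<open>D\<close> be improved by the factor
  \<open>2 powr (1 - \<theta>) < 1\<close> any number of times.\<close>

lemma midpoint_additive_eq_0:
  fixes D :: "real \<Rightarrow> real \<Rightarrow> real"
  assumes "1 < \<theta>"
    and bound: "\<And>u v. u \<le> v \<Longrightarrow> \<bar>D u v\<bar> \<le> C * (v - u) powr \<theta>"
    and add: "\<And>u v. u \<le> v \<Longrightarrow> D u v = D u ((u + v) / 2) + D ((u + v) / 2) v"
    and "u \<le> v"
  shows "D u v = 0"
proof -
  have "\<bar>D u v\<bar> \<le> C * (2 powr (1 - \<theta>)) ^ n * (v - u) powr \<theta>" if "u \<le> v" for n u v
    using that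
  proof (induction n arbitrary: u v)
    case (Suc n)
    show ?case
      using dyadic_step[where D = D and E = D, OF Suc.IH add Suc.prems] by (simp add: mult_ac)
  qed (use bound in auto)
  moreover have "(\<lambda>n. C * (2 powr (1 - \<theta>)) ^ n * (v - u) powr \<theta>) \<longlonglongrightarrow> C * 0 * (v - u) powr \<theta>"
    using \<open>1 < \<theta>\<close> by (intro tendsto_intros LIMSEQ_power_zero) (simp add: powr_less_one)
  ultimately have "\<bar>D u v\<bar> \<le> C * 0 * (v - u) powr \<theta>"
    using \<open>u \<le> v\<close> by (intro LIMSEQ_le_const) auto
  then show ?thesis by simp
qed

text \<open>\<open>J\<close> is the limit of the dyadic sums, written as \<open>X\<close> plus a
  telescoping series with a geometric majorant. Summing the majorant gives closeness to
  \<open>X\<close>, the recursion passes to the limit as midpoint additivity, and on bounded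
  triangles the majorant is uniform, so continuity survives.\<close>

lemma dyadic_sum_limit:
  fixes X :: "real \<Rightarrow> real \<Rightarrow> real"
  assumes \<theta>: "1 < \<theta>"
    and X: "\<And>u m v. u \<le> m \<Longrightarrow> m \<le> v \<Longrightarrow> \<bar>X u v - X u m - X m v\<bar> \<le> C * (v - u) powr \<theta>"
    and cont: "continuous_on UNIV (\<lambda>(u, v). X u v)"
  obtains J K where "\<And>u v. u \<le> v \<Longrightarrow> \<bar>J u v - X u v\<bar> \<le> K * (v - u) powr \<theta>"
    and "\<And>u v. u \<le> v \<Longrightarrow> J u v = J u ((u + v) / 2) + J ((u + v) / 2) v"
    and "\<And>a b. continuous_on {p. a \<le> fst p \<and> fst p \<le> snd p \<and> snd p \<le> b} (\<lambda>(u, v). J u v)"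
proof -
  define q where "q = 2 powr (1 - \<theta>)"
  have q: "0 \<le> q" "q < 1"
    using \<theta> by (auto simp: q_def powr_less_one)
  \<comment> \<open>On \<open>[0, 1]\<close> the power equals 1, so \<open>C\<close> bounds an
    absolute value.\<close>
  have C: "0 \<le> C"
    using order_trans[OF abs_ge_zero X[of 0 0 1]] by simp
  define d where "d k u v = dyadic_sum X (Suc k) u v - dyadic_sum X k u v" for k u v
  have d: "\<bar>d k u v\<bar> \<le> C * (v - u) powr \<theta> * q ^ k" if "u \<le> v" for k u v
    using dyadic_sum_diff[where X = X, OF X that] by (simp add: q_def d_def mult_ac)
  have sq: "summable (\<lambda>k. B * q ^ k)" for B
    using q by (intro summable_mult summable_geometric) auto
  have sd: "summable (\<lambda>k. d k u v)" if "u \<le> v" for u v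
    by (rule summable_comparison_test[OF _ sq]) (use d[OF that] in auto)
  define J where "J u v = X u v + (\<Sum>k. d k u v)" for u v
  have sum_d: "X u v + (\<Sum>k<n. d k u v) = dyadic_sum X n u v" for n u v
    by (induction n) (simp_all add: d_def del: dyadic_sum.simps(2))
  have lim: "(\<lambda>n. dyadic_sum X n u v) \<longlonglongrightarrow> J u v" if "u \<le> v" for u v
    unfolding J_def sum_d[symmetric] by (intro tendsto_intros summable_LIMSEQ sd that)
  show thesis
  proof
    show "\<bar>J u v - X u v\<bar> \<le> C / (1 - q) * (v - u) powr \<theta>" if "u \<le> v" for u v
    proof -
      have "norm (\<Sum>k. d k u v) \<le> (\<Sum>k. C * (v - u) powr \<theta> * q ^ k)"
        by (rule norm_suminf_le[OF _ sq]) (use d[OF that] in auto)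
      also have "\<dots> = C / (1 - q) * (v - u) powr \<theta>"
        using q by (simp add: suminf_mult suminf_geometric summable_geometric)
      finally show ?thesis by (simp add: J_def)
    qed
    show "J u v = J u ((u + v) / 2) + J ((u + v) / 2) v" if "u \<le> v" for u v
    proof (rule LIMSEQ_unique)
      show "(\<lambda>n. dyadic_sum X (Suc n) u v) \<longlonglongrightarrow> J u v"
        using lim[OF that] by (rule LIMSEQ_Suc)
      show "(\<lambda>n. dyadic_sum X (Suc n) u v) \<longlonglongrightarrow> J u ((u + v) / 2) + J ((u + v) / 2) v"
        using that by (simp, intro tendsto_add lim) auto
    qed
    show "continuous_on {p. a \<le> fst p \<and> fst p \<le> snd p \<and> snd p \<le> b} (\<lambda>(u, v). J u v)"
      (is "continuous_on ?S _") for a b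
    proof (rule uniform_limit_theorem)
      have "continuous_on UNIV (\<lambda>p. dyadic_sum X n (fst p) (snd p))" for n
      proof (induction n)
        case 0
        then show ?case using cont by (simp add: case_prod_beta)
      next
        case (Suc n)
        show ?case
          by (auto intro!: continuous_intros continuous_on_compose2[OF Suc, of _ "\<lambda>p. (fst p, (fst p + snd p) / 2)", simplified]
            continuous_on_compose2[OF Suc, of _ "\<lambda>p. ((fst p + snd p) / 2, snd p)", simplified])
      qed
      then have "continuous_on ?S (\<lambda>p. dyadic_sum X n (fst p) (snd p))" for n
        by (rule continuous_on_subset) simp
      then show "\<forall>\<^sub>F n in sequentially. continuous_on ?S (\<lambda>p. dyadic_sum X n (fst p) (snd p))"
        by simp
      have "uniform_limit ?S (\<lambda>n p. \<Sum>k<n. d k (fst p) (snd p)) (\<lambda>p. \<Sum>k. d k (fst p) (snd p)) sequentially"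
      proof (rule Weierstrass_m_test[OF _ sq])
        fix k p assume "p \<in> ?S"
        then have p: "fst p \<le> snd p" "snd p - fst p \<le> b - a" by auto
        have "\<bar>d k (fst p) (snd p)\<bar> \<le> C * (snd p - fst p) powr \<theta> * q ^ k"
          using d[OF p(1)] .
        also have "\<dots> \<le> C * (b - a) powr \<theta> * q ^ k"
          using p C q \<theta> by (intro mult_right_mono mult_left_mono powr_mono2) auto
        finally show "norm (d k (fst p) (snd p)) \<le> C * (b - a) powr \<theta> * q ^ k" by simp
      qed
      from uniform_limit_add[OF uniform_limit_const this, of "\<lambda>p. X (fst p) (snd p)"]
      show "uniform_limit ?S (\<lambda>n p. dyadic_sum X n (fst p) (snd p)) (\<lambda>(u, v). J u v) sequentially"
        by (simp add: sum_d J_def case_prod_unfold)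
    qed simp
  qed
qed

lemma sum_double:
  fixes a :: "nat \<Rightarrow> 'a::comm_monoid_add"
  shows "(\<Sum>k<2 * N. a k) = (\<Sum>i<N. a (2 * i) + a (2 * i + 1))"
  by (induction N) (simp_all add: add.assoc)

text \<open>The \<open>N\<close>-fold refinement of a midpoint-additive functional is again midpoint-additive and
  close to the same germ, hence equal to it.\<close>

lemma midpoint_additive_uniform_sum:
  fixes J X :: "real \<Rightarrow> real \<Rightarrow> real" and N :: nat
  assumes \<theta>: "1 < \<theta>"
    and X: "\<And>u m v. u \<le> m \<Longrightarrow> m \<le> v \<Longrightarrow> \<bar>X u v - X u m - X m v\<bar> \<le> C * (v - u) powr \<theta>"
    and JX: "\<And>u v. u \<le> v \<Longrightarrow> \<bar>J u v - X u v\<bar> \<le> K * (v - u) powr \<theta>"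
    and J: "\<And>u v. u \<le> v \<Longrightarrow> J u v = J u ((u + v) / 2) + J ((u + v) / 2) v"
    and uv: "u \<le> v" and N: "0 < N"
  shows "J u v = (\<Sum>i<N. J (u + i * ((v - u) / N)) (u + (i + 1) * ((v - u) / N)))"
proof -
  have C: "0 \<le> C" and K: "0 \<le> K"
    using order_trans[OF abs_ge_zero X[of 0 0 1]] order_trans[OF abs_ge_zero JX[of 0 1]] by simp_all
  define pt where "pt u v i = u + real i * ((v - u) / N)" for u v :: real and i
  have pt0: "pt u v 0 = u" and ptN: "pt u v N = v" for u v
    using N by (auto simp: pt_def)
  have pt_mono: "pt u v i \<le> pt u v k" if "u \<le> v" "i \<le> k" for u v i k
    using that N by (auto simp: pt_def intro!: mult_right_mono divide_right_mono)
  define S where "S Y u v = (\<Sum>i<N. Y (pt u v i) (pt u v (Suc i)))"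
    for Y :: "real \<Rightarrow> real \<Rightarrow> real" and u v
  \<comment> \<open>The constant may depend on \<open>N\<close>, which stays fixed: the vanishing
    argument only needs some constant with an exponent above 1.\<close>
  have "\<bar>J u v - S J u v\<bar> \<le> (K + N * C + N * K) * (v - u) powr \<theta>" if uv: "u \<le> v" for u v
  proof -
    have X0: "X w w = 0" for w
      using X[of w w w] by simp
    \<comment> \<open>The points are split off one at a time, each at the cost of one additivity
      defect of \<open>X\<close> on a subinterval of \<open>[u, v]\<close>.\<close>
    have sumX: "\<bar>X u (pt u v n) - (\<Sum>i<n. X (pt u v i) (pt u v (Suc i)))\<bar> \<le> n * C * (v - u) powr \<theta>"
      if "n \<le> N" for n
      using that
    proof (induction n)
      case (Suc n)
      have "\<bar>X u (pt u v (Suc n)) - X u (pt u v n) - X (pt u v n) (pt u v (Suc n))\<bar>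
          \<le> C * (pt u v (Suc n) - u) powr \<theta>"
        by (rule X) (use pt_mono[OF uv, of 0 n] pt_mono[OF uv, of n "Suc n"] pt0 in auto)
      also have "\<dots> \<le> C * (v - u) powr \<theta>"
        using pt_mono[OF uv, of 0 "Suc n"] pt_mono[OF uv Suc.prems] pt0[of u v] ptN[of u v] C \<theta>
        by (intro mult_left_mono powr_mono2) auto
      finally show ?case
        using Suc by (simp add: algebra_simps)
    qed (simp add: pt0 X0)
    have "\<bar>S X u v - S J u v\<bar> \<le> (\<Sum>i<N. \<bar>X (pt u v i) (pt u v (Suc i)) - J (pt u v i) (pt u v (Suc i))\<bar>)"
      unfolding S_def by (simp flip: sum_subtractf)
    also have "\<dots> \<le> (\<Sum>i<N. K * (v - u) powr \<theta>)"
    proof (rule sum_mono)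
      fix i assume "i \<in> {..<N}"
      then have i: "u \<le> pt u v i" "pt u v i \<le> pt u v (Suc i)" "pt u v (Suc i) \<le> v"
        using pt_mono[OF uv, of 0 i] pt_mono[OF uv, of i "Suc i"] pt_mono[OF uv, of "Suc i" N]
        by (auto simp: pt0 ptN)
      have "\<bar>X (pt u v i) (pt u v (Suc i)) - J (pt u v i) (pt u v (Suc i))\<bar>
          \<le> K * (pt u v (Suc i) - pt u v i) powr \<theta>"
        using JX[OF i(2)] by (simp add: abs_minus_commute)
      also have "\<dots> \<le> K * (v - u) powr \<theta>"
        using i K \<theta> by (intro mult_left_mono powr_mono2) auto
      finally show "\<bar>X (pt u v i) (pt u v (Suc i)) - J (pt u v i) (pt u v (Suc i))\<bar>
          \<le> K * (v - u) powr \<theta>" .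
    qed
    also have "\<dots> = N * K * (v - u) powr \<theta>" by simp
    finally have "\<bar>S X u v - S J u v\<bar> \<le> N * K * (v - u) powr \<theta>" .
    moreover have "\<bar>X u v - S X u v\<bar> \<le> N * C * (v - u) powr \<theta>"
      using sumX[of N] by (simp add: S_def ptN)
    ultimately show ?thesis
      using JX[OF uv] by (simp add: algebra_simps)
  qed
  note bound = this
  have split: "S J u v = S J u ((u + v) / 2) + S J ((u + v) / 2) v" if uv: "u \<le> v" for u v
  proof -
    let ?m = "(u + v) / 2"
    \<comment> \<open>The grid of \<open>2 * N\<close> cells is read in two ways: as the
      \<open>N\<close> cells of \<open>[u, v]\<close> cut at their midpoints, and as the
      \<open>N\<close> cells of each half of \<open>[u, v]\<close>.\<close>
    define c where "c k = u + real k * ((v - u) / (2 * N))" for k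
    have mid: "(pt u v i + pt u v (Suc i)) / 2 = c (2 * i + 1)" for i
      using N by (simp add: pt_def c_def field_simps)
    have ends: "pt u v i = c (2 * i)" "pt u v (Suc i) = c (2 * i + 2)" for i
      using N by (simp_all add: pt_def c_def field_simps)
    have halves: "pt u ?m i = c i" "pt ?m v i = c (N + i)" for i
      using N by (simp_all add: pt_def c_def field_simps)
    have "S J u v = (\<Sum>i<N. J (c (2 * i)) (c (2 * i + 1)) + J (c (2 * i + 1)) (c (2 * i + 2)))"
      unfolding S_def
    proof (rule sum.cong)
      fix i
      show "J (pt u v i) (pt u v (Suc i))
          = J (c (2 * i)) (c (2 * i + 1)) + J (c (2 * i + 1)) (c (2 * i + 2))"
        using J[OF pt_mono[OF uv, of i "Suc i"]] unfolding mid unfolding ends by simp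
    qed simp
    also have "\<dots> = (\<Sum>k<2 * N. J (c k) (c (Suc k)))"
      by (simp add: sum_double)
    also have "\<dots> = (\<Sum>k<N. J (c k) (c (Suc k))) + (\<Sum>k<N. J (c (N + k)) (c (Suc (N + k))))"
      using sum.atLeastLessThan_concat[of 0 N "2 * N" "\<lambda>k. J (c k) (c (Suc k))"]
        sum.shift_bounds_nat_ivl[of "\<lambda>k. J (c k) (c (Suc k))" 0 N N]
      by (simp add: lessThan_atLeast0 add.commute mult_2)
    finally show ?thesis
      by (simp add: S_def halves)
  qed
  have "J u v - S J u v = 0"
  proof (rule midpoint_additive_eq_0[where D = "\<lambda>u v. J u v - S J u v", OF \<theta> bound _ uv])
    show "J u v - S J u v = J u ((u + v) / 2) - S J u ((u + v) / 2)
        + (J ((u + v) / 2) v - S J ((u + v) / 2) v)" if "u \<le> v" for u v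
      using J[OF that] split[OF that] by linarith
  qed
  then show ?thesis
    by (simp add: S_def pt_def add.commute)
qed

text \<open>Additivity over \<open>N\<close> equal cells allows a split at every point dividing
  \<open>[u, v]\<close> in a rational ratio; such points are dense, and continuity of
  \<open>J\<close> reaches the remaining ones.\<close>

lemma midpoint_additive_imp_additive:
  fixes J X :: "real \<Rightarrow> real \<Rightarrow> real"
  assumes \<theta>: "1 < \<theta>"
    and X: "\<And>u m v. u \<le> m \<Longrightarrow> m \<le> v \<Longrightarrow> \<bar>X u v - X u m - X m v\<bar> \<le> C * (v - u) powr \<theta>"
    and JX: "\<And>u v. u \<le> v \<Longrightarrow> \<bar>J u v - X u v\<bar> \<le> K * (v - u) powr \<theta>"
    and J: "\<And>u v. u \<le> v \<Longrightarrow> J u v = J u ((u + v) / 2) + J ((u + v) / 2) v"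
    and cont: "\<And>a b. continuous_on {p. a \<le> fst p \<and> fst p \<le> snd p \<and> snd p \<le> b} (\<lambda>(u, v). J u v)"
    and uwv: "u \<le> w" "w \<le> v"
  shows "J u v = J u w + J w v"
proof -
  have U: "J u v = (\<Sum>i<N. J (u + i * ((v - u) / N)) (u + (i + 1) * ((v - u) / N)))"
    if "u \<le> v" "0 < N" for u v and N :: nat
    by (rule midpoint_additive_uniform_sum[where J = J and X = X and C = C and K = K,
          OF \<theta> X JX J that])
  have J0: "J w w = 0" for w
    using J[of w w] by simp
  define l where "l = v - u"
  have l: "0 \<le> l" using uwv by (simp add: l_def)
  have rational: "J u v = J u (u + p * (l / N)) + J (u + p * (l / N)) v"
    if p: "p \<le> N" and N: "0 < N" for p N :: nat
  proof -
    define c where "c i = u + real i * (l / N)" for i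
    have cN: "c N = v" "c 0 = u" using N by (auto simp: c_def l_def)
    have c_mono: "c i \<le> c k" if "i \<le> k" for i k
      using that l N by (auto simp: c_def intro!: mult_right_mono divide_right_mono)
    \<comment> \<open>A run of \<open>n\<close> cells has step \<open>l / N\<close> again, so its
      own \<open>n\<close>-fold refinement uses the same grid points.\<close>
    have part: "J (c i) (c (i + n)) = (\<Sum>k<n. J (c (i + k)) (c (Suc (i + k))))" for i n
    proof (cases "n = 0")
      case False
      have e: "(c (i + n) - c i) / n = l / N"
        using False N by (simp add: c_def field_simps)
      show ?thesis
        using U[OF c_mono[of i "i + n"], of n] False unfolding e
        by (simp add: c_def algebra_simps add_divide_distrib)
    qed (simp add: J0)
    have "J (c 0) (c N) = J (c 0) (c p) + J (c p) (c N)"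
      using part[of 0 N] part[of 0 p] part[of p "N - p"] p
        sum.atLeastLessThan_concat[of 0 p N "\<lambda>k. J (c k) (c (Suc k))"]
        sum.shift_bounds_nat_ivl[of "\<lambda>k. J (c k) (c (Suc k))" 0 p "N - p"]
      by (simp add: lessThan_atLeast0 add.commute)
    then show ?thesis
      using cN by (simp add: c_def)
  qed
  \<comment> \<open>If \<open>l = 0\<close>, then \<open>u = w = v\<close> and any ratio in
    \<open>[0, 1]\<close> would serve.\<close>
  define x where "x = (if l = 0 then 0 else (w - u) / l)"
  have x: "0 \<le> x" "x \<le> 1" "w = u + x * l"
    using uwv l by (auto simp: x_def l_def field_simps)
  \<comment> \<open>Rational approximation of \<open>x\<close> from below with error at most
    \<open>1 / Suc n\<close>; the denominator \<open>Suc n\<close> is never zero, and the numerator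
    does not exceed it because \<open>x \<le> 1\<close>.\<close>
  define y where "y n = real (nat \<lfloor>x * Suc n\<rfloor>) / Suc n" for n
  have y_le: "y n \<le> x" for n
    using x by (simp add: y_def field_simps) 
  have y_ge: "x - 1 / Suc n \<le> y n" for n
  proof -
    have "x * Suc n - 1 \<le> real (nat \<lfloor>x * Suc n\<rfloor>)"
      using x by linarith
    then have "(x * Suc n - 1) / Suc n \<le> y n"
      unfolding y_def by (rule divide_right_mono) simp
    then show ?thesis by (simp add: diff_divide_distrib)
  qed
  have y: "y \<longlonglongrightarrow> x"
  proof (rule tendsto_sandwich)
    show "(\<lambda>n. x - 1 / Suc n) \<longlonglongrightarrow> x"
      using tendsto_diff[OF tendsto_const LIMSEQ_Suc[OF lim_1_over_n], of x] by simp
  qed (use y_le y_ge in auto)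
  have y01: "0 \<le> y n" "y n \<le> 1" for n
    using order_trans[OF y_le x(2)] by (simp_all add: y_def)
  define f where "f s = J u (u + s * l) + J (u + s * l) v" for s
  have yl: "u + s * l \<le> v" if "s \<le> 1" for s
    using mult_right_mono[OF that l] by (simp add: l_def)
  have "continuous_on {0..1} (\<lambda>s. case (u, u + s * l) of (u, v) \<Rightarrow> J u v)"
    by (rule continuous_on_compose2[OF cont[of u v]]) 
      (use l yl in \<open>auto intro!: continuous_intros \<close>)
  moreover have "continuous_on {0..1} (\<lambda>s. case (u + s * l, v) of (u, v) \<Rightarrow> J u v)"
    by (rule continuous_on_compose2[OF cont[of u v]])
      (use l yl in \<open>auto intro!: continuous_intros \<close>)
  ultimately have "continuous_on {0..1} f"
    unfolding f_def by (auto intro: continuous_on_add)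
  then have "(\<lambda>n. f (y n)) \<longlonglongrightarrow> f x"
    by (rule continuous_on_tendsto_compose[OF _ y]) (use x y01 in auto)
  moreover have "f (y n) = J u v" for n
  proof -
    have "x * Suc n \<le> Suc n"
      using mult_right_mono[OF x(2), of "real (Suc n)"] by simp
    from floor_mono[OF this] have "nat \<lfloor>x * Suc n\<rfloor> \<le> Suc n"
      by (simp only: floor_of_nat nat_le_iff)
    then show ?thesis
      using rational[of "nat \<lfloor>x * Suc n\<rfloor>" "Suc n"] by (simp add: f_def y_def)
  qed
  ultimately have "f x = J u v"
    by (simp add: LIMSEQ_const_iff)
  then show ?thesis
    using x by (simp add: f_def)
qed

text \<open>For the additive limit \<open>J\<close> of the dyadic sums, \<open>J a\<close> is a
  primitive. Since \<open>J\<close> is controlled on ordered pairs, the estimate starts at the base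
  point \<open>a\<close>.\<close>

lemma sewing:
  fixes X :: "real \<Rightarrow> real \<Rightarrow> real"
  assumes "1 < \<theta>"
    and "\<And>u m v. u \<le> m \<Longrightarrow> m \<le> v \<Longrightarrow> \<bar>X u v - X u m - X m v\<bar> \<le> C * (v - u) powr \<theta>"
    and "continuous_on UNIV (\<lambda>(u, v). X u v)"
  obtains I K where "\<And>u v. a \<le> u \<Longrightarrow> u \<le> v \<Longrightarrow> \<bar>I v - I u - X u v\<bar> \<le> K * (v - u) powr \<theta>"
proof -
  obtain J K where J: "\<And>u v. u \<le> v \<Longrightarrow> \<bar>J u v - X u v\<bar> \<le> K * (v - u) powr \<theta>"
    "\<And>u v. u \<le> v \<Longrightarrow> J u v = J u ((u + v) / 2) + J ((u + v) / 2) v"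
    "\<And>a b. continuous_on {p. a \<le> fst p \<and> fst p \<le> snd p \<and> snd p \<le> b} (\<lambda>(u, v). J u v)"
    using dyadic_sum_limit[where X = X, OF assms] by blast
  have "J a v = J a u + J u v" if "a \<le> u" "u \<le> v" for u v
    by (rule midpoint_additive_imp_additive[where J = J and X = X, OF assms(1,2) J that])
  then have "\<bar>J a v - J a u - X u v\<bar> \<le> K * (v - u) powr \<theta>" if "a \<le> u" "u \<le> v" for u v
    using J(1)[of u v] that by (metis add_diff_cancel_left')
  then show thesis
    by (rule that)
qed

section \<open>Young integration\<close>

lemma holder_onE:
  assumes "holder_on \<alpha> S f"
  obtains C where "0 \<le> C" "\<And>s t. s \<in> S \<Longrightarrow> t \<in> S \<Longrightarrow> \<bar>f s - f t\<bar> \<le> C * \<bar>s - t\<bar> powr \<alpha>"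
proof -
  obtain C where C: "\<And>s t. s \<in> S \<Longrightarrow> t \<in> S \<Longrightarrow> \<bar>f s - f t\<bar> \<le> C * \<bar>s - t\<bar> powr \<alpha>"
    using assms unfolding holder_on_def by blast
  have "\<bar>f s - f t\<bar> \<le> \<bar>C\<bar> * \<bar>s - t\<bar> powr \<alpha>" if "s \<in> S" "t \<in> S" for s t
    using C[OF that] by (rule order_trans) (simp add: mult_right_mono)
  then show thesis
    using that[of "\<bar>C\<bar>"] by simp
qed

lemma holder_on_imp_continuous_on:
  assumes "holder_on \<alpha> S f" "0 < \<alpha>"
  shows "continuous_on S f"
proof -
  obtain C where C: "0 \<le> C" "\<And>s t. s \<in> S \<Longrightarrow> t \<in> S \<Longrightarrow> \<bar>f s - f t\<bar> \<le> C * \<bar>s - t\<bar> powr \<alpha>"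
    using holder_onE[OF assms(1)] by blast
  have "(f \<longlongrightarrow> f x) (at x within S)" if x: "x \<in> S" for x
  proof (rule LIM_zero_cancel, rule Lim_null_comparison)
    show "\<forall>\<^sub>F y in at x within S. norm (f y - f x) \<le> C * \<bar>y - x\<bar> powr \<alpha>"
      using C(2) x by (simp add: eventually_at_filter)
    have "((\<lambda>y. C * \<bar>y - x\<bar> powr \<alpha>) \<longlongrightarrow> C * \<bar>x - x\<bar> powr \<alpha>) (at x within S)"
      using assms(2) by (intro tendsto_intros) simp_all
    then show "((\<lambda>y. C * \<bar>y - x\<bar> powr \<alpha>) \<longlongrightarrow> 0) (at x within S)" by simp
  qed
  then show ?thesis
    unfolding continuous_on_def by blast
qed

text \<open>Clamping to \<open>[a, b]\<close> does not increase distances, so the constant extension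
  keeps exponent and constant. It supplies the functions on the whole line that the sewing argument
  takes as input.\<close>

lemma holder_on_clamp:
  assumes "holder_on \<alpha> {a..b} f" "a \<le> b" "0 \<le> \<alpha>"
  shows "holder_on \<alpha> UNIV (\<lambda>s. f (max a (min b s)))"
proof -
  obtain C where C: "0 \<le> C" "\<And>s t. s \<in> {a..b} \<Longrightarrow> t \<in> {a..b} \<Longrightarrow> \<bar>f s - f t\<bar> \<le> C * \<bar>s - t\<bar> powr \<alpha>"
    using holder_onE[OF assms(1)] by blast
  have "\<bar>f (max a (min b s)) - f (max a (min b t))\<bar> \<le> C * \<bar>s - t\<bar> powr \<alpha>" for s t
  proof -
    have "\<bar>f (max a (min b s)) - f (max a (min b t))\<bar> \<le> C * \<bar>max a (min b s) - max a (min b t)\<bar> powr \<alpha>"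
      using assms(2) by (intro C) auto
    also have "\<dots> \<le> C * \<bar>s - t\<bar> powr \<alpha>"
      using C assms(3) by (intro mult_left_mono powr_mono2) auto
    finally show ?thesis .
  qed
  then show ?thesis
    unfolding holder_on_def by blast
qed

text \<open>The additivity defect of the germ \<open>f u * (g v - g u)\<close> factorises as
  \<open>(f u - f m) * (g v - g m)\<close>, which is of order
  \<open>\<alpha> + \<beta> > 1\<close>.\<close>

lemma young_primitive:
  assumes f: "holder_on \<alpha> UNIV f" and g: "holder_on \<beta> UNIV g"
    and \<alpha>: "0 < \<alpha>" and \<beta>: "0 < \<beta>" and \<alpha>\<beta>: "1 < \<alpha> + \<beta>"
  obtains I K where
    "\<And>u v. a \<le> u \<Longrightarrow> u \<le> v \<Longrightarrow> \<bar>I v - I u - f u * (g v - g u)\<bar> \<le> K * (v - u) powr (\<alpha> + \<beta>)"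
proof -
  obtain A where A: "0 \<le> A" "\<And>s t. \<bar>f s - f t\<bar> \<le> A * \<bar>s - t\<bar> powr \<alpha>"
    using holder_onE[OF f] by auto
  obtain B where B: "0 \<le> B" "\<And>s t. \<bar>g s - g t\<bar> \<le> B * \<bar>s - t\<bar> powr \<beta>"
    using holder_onE[OF g] by auto
  have "\<bar>f u * (g v - g u) - f u * (g m - g u) - f m * (g v - g m)\<bar>
      \<le> A * B * (v - u) powr (\<alpha> + \<beta>)" if m: "u \<le> m" "m \<le> v" for u m v
  proof -
    have "f u * (g v - g u) - f u * (g m - g u) - f m * (g v - g m) = (f u - f m) * (g v - g m)"
      by (simp add: algebra_simps)
    also have "\<bar>\<dots>\<bar> \<le> (A * (v - u) powr \<alpha>) * (B * (v - u) powr \<beta>)"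
      unfolding abs_mult
    proof (rule mult_mono)
      show "\<bar>f u - f m\<bar> \<le> A * (v - u) powr \<alpha>"
        using A(1) m \<alpha> by (intro order_trans[OF A(2)] mult_left_mono powr_mono2) auto
      show "\<bar>g v - g m\<bar> \<le> B * (v - u) powr \<beta>"
        using B(1) m \<beta> by (intro order_trans[OF B(2)] mult_left_mono powr_mono2) auto
    qed (use A in auto)
    finally show ?thesis
      by (simp add: powr_add mult_ac)
  qed
  moreover have "continuous_on UNIV (\<lambda>(u, v). f u * (g v - g u))"
    unfolding case_prod_unfold
    by (intro continuous_intros
        continuous_on_compose2[OF holder_on_imp_continuous_on[OF f \<alpha>]]
        continuous_on_compose2[OF holder_on_imp_continuous_on[OF g \<beta>]]) auto
  ultimately show thesis
    using that by (rule sewing[where X = "\<lambda>u v. f u * (g v - g u)", OF \<alpha>\<beta>])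
qed

text \<open>The increments of \<open>I\<close> telescope over the cells, and so do the lengths in
  the error bound. The gauge is left general to serve both Riemann--Stieltjes sums, where its radius
  is constant, and Henstock--Kurzweil sums, where it depends on the tag.\<close>

lemma tagged_division_telescope_le:
  fixes a b :: real
  assumes "a \<le> b" and p: "p tagged_division_of {a..b}" and fine: "\<gamma> fine p"
    and bound: "\<And>x u v. a \<le> u \<Longrightarrow> u \<le> x \<Longrightarrow> x \<le> v \<Longrightarrow> v \<le> b \<Longrightarrow> {u..v} \<subseteq> \<gamma> x \<Longrightarrow>
      \<bar>S x u v - (I v - I u)\<bar> \<le> e * (v - u)"
  shows "\<bar>(\<Sum>(x, K)\<in>p. S x (Inf K) (Sup K)) - (I b - I a)\<bar> \<le> e * (b - a)"
proof -
  have "\<bar>(\<Sum>(x, K)\<in>p. S x (Inf K) (Sup K)) - (I b - I a)\<bar>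
      = \<bar>\<Sum>(x, K)\<in>p. S x (Inf K) (Sup K) - (I (Sup K) - I (Inf K))\<bar>"
    using additive_tagged_division_1[OF assms(1) p, of I] by (simp add: case_prod_unfold sum_subtractf)
  also have "\<dots> \<le> (\<Sum>(x, K)\<in>p. \<bar>S x (Inf K) (Sup K) - (I (Sup K) - I (Inf K))\<bar>)"
    unfolding case_prod_unfold by (rule sum_abs)
  also have "\<dots> \<le> (\<Sum>(x, K)\<in>p. e * (Sup K - Inf K))"
  proof (rule sum_mono, safe)
    fix x K assume xK: "(x, K) \<in> p"
    then have "x \<in> K" "K \<subseteq> {a..b}"
      using p by blast+
    moreover obtain u v where uv: "K = {u..v}"
      using tagged_division_ofD(4)[OF p xK] by auto
    moreover have "K \<subseteq> \<gamma> x"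
      using fine xK by blast
    ultimately show "\<bar>S x (Inf K) (Sup K) - (I (Sup K) - I (Inf K))\<bar> \<le> e * (Sup K - Inf K)"
      using bound[of u x v] by auto
  qed
  also have "\<dots> = e * (b - a)"
    using additive_tagged_division_1[OF assms(1) p, of "\<lambda>x. x"]
    by (simp add: case_prod_unfold flip: sum_distrib_left)
  finally show ?thesis .
qed

lemma has_rs_integral_iff:
  "has_rs_integral f g a b I \<longleftrightarrow>
     (\<forall>e>0. \<exists>d>0. \<forall>p. p tagged_division_of {a..b} \<and> (\<lambda>x. ball x d) fine p \<longrightarrow>
        \<bar>(\<Sum>(x, K)\<in>p. f x * (g (Sup K) - g (Inf K))) - I\<bar> \<le> e)"
proof
  assume R: "\<forall>e>0. \<exists>d>0. \<forall>p. p tagged_division_of {a..b} \<and> (\<lambda>x. ball x d) fine p \<longrightarrow>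
        \<bar>(\<Sum>(x, K)\<in>p. f x * (g (Sup K) - g (Inf K))) - I\<bar> \<le> e"
  show "has_rs_integral f g a b I"
    unfolding has_rs_integral_def
  proof (intro allI impI)
    fix e :: real assume "0 < e"
    then obtain d where "d > 0" "\<forall>p. p tagged_division_of {a..b} \<and> (\<lambda>x. ball x d) fine p \<longrightarrow>
        \<bar>(\<Sum>(x, K)\<in>p. f x * (g (Sup K) - g (Inf K))) - I\<bar> \<le> e / 2"
      using R[rule_format, of "e / 2"] by auto
    then show "\<exists>d>0. \<forall>p. p tagged_division_of {a..b} \<and> (\<lambda>x. ball x d) fine p \<longrightarrow>
        \<bar>(\<Sum>(x, K)\<in>p. f x * (g (Sup K) - g (Inf K))) - I\<bar> < e"
      using \<open>0 < e\<close> by fastforce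
  qed
next
  assume "has_rs_integral f g a b I"
  then show "\<forall>e>0. \<exists>d>0. \<forall>p. p tagged_division_of {a..b} \<and> (\<lambda>x. ball x d) fine p \<longrightarrow>
        \<bar>(\<Sum>(x, K)\<in>p. f x * (g (Sup K) - g (Inf K))) - I\<bar> \<le> e"
    unfolding has_rs_integral_def by (meson less_imp_le)
qed

text \<open>On cells of length at most \<open>2 * d\<close>, the bound
  \<open>K * (v - u) powr \<theta>\<close> is at most \<open>K * (2 * d) powr (\<theta> - 1)\<close>
  times the length, and the first factor tends to 0 with the mesh.\<close>

lemma has_rs_integral_primitive:
  fixes f g I :: "real \<Rightarrow> real"
  assumes ab: "a \<le> b" and \<theta>: "1 < \<theta>" and K: "0 \<le> K"
    and bound: "\<And>x u v. a \<le> u \<Longrightarrow> u \<le> x \<Longrightarrow> x \<le> v \<Longrightarrow> v \<le> b \<Longrightarrow>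
      \<bar>f x * (g v - g u) - (I v - I u)\<bar> \<le> K * (v - u) powr \<theta>"
  shows "has_rs_integral f g a b (I b - I a)"
  unfolding has_rs_integral_iff
proof (intro allI impI)
  fix e :: real assume e: "0 < e"
  have "((\<lambda>d. K * (2 * d) powr (\<theta> - 1) * (b - a)) \<longlongrightarrow> K * (2 * 0) powr (\<theta> - 1) * (b - a)) (at_right 0)"
    using \<theta> by (intro tendsto_intros) (auto simp: eventually_at_filter)
  then have "\<forall>\<^sub>F d in at_right 0. K * (2 * d) powr (\<theta> - 1) * (b - a) < e"
    using e by (intro order_tendstoD(2)) auto
  then have "\<forall>\<^sub>F d in at_right 0. K * (2 * d) powr (\<theta> - 1) * (b - a) < e \<and> (0 :: real) < d"
    by (intro eventually_conj eventually_at_right_less)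
  then obtain d where d: "0 < d" "K * (2 * d) powr (\<theta> - 1) * (b - a) < e"
    using eventually_happens'[OF trivial_limit_at_right_real] by blast
  have "\<bar>(\<Sum>(x, L)\<in>p. f x * (g (Sup L) - g (Inf L))) - (I b - I a)\<bar> \<le> e"
    if p: "p tagged_division_of {a..b}" "(\<lambda>x. ball x d) fine p" for p
  proof -
    have "\<bar>f x * (g v - g u) - (I v - I u)\<bar> \<le> K * (2 * d) powr (\<theta> - 1) * (v - u)"
      if x: "a \<le> u" "u \<le> x" "x \<le> v" "v \<le> b" "{u..v} \<subseteq> ball x d" for x u v
    proof -
      have "u \<in> ball x d" "v \<in> ball x d"
        using x(2,3) by (auto intro!: subsetD[OF x(5)] simp del: mem_ball)
      then have vu: "v - u \<le> 2 * d"
        by (auto simp: dist_real_def)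
      have "(v - u) powr \<theta> = (v - u) powr (\<theta> - 1) * (v - u)"
        using x powr_add[of "v - u" "\<theta> - 1" 1] by (cases "v = u") auto
      also have "\<dots> \<le> (2 * d) powr (\<theta> - 1) * (v - u)"
        using x vu \<theta> by (intro mult_right_mono powr_mono2) auto
      finally have "K * (v - u) powr \<theta> \<le> K * ((2 * d) powr (\<theta> - 1) * (v - u))"
        using K by (rule mult_left_mono)
      then show ?thesis
        using bound[OF x(1-4)] by (simp add: mult.assoc)
    qed
    from tagged_division_telescope_le[OF ab p, of "\<lambda>x u v. f x * (g v - g u)", OF this]
    show ?thesis
      using d(2) by simp
  qed
  then show "\<exists>d>0. \<forall>p. p tagged_division_of {a..b} \<and> (\<lambda>x. ball x d) fine p \<longrightarrow>
      \<bar>(\<Sum>(x, K)\<in>p. f x * (g (Sup K) - g (Inf K))) - (I b - I a)\<bar> \<le> e"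
    using d(1) by blast
qed

lemma rs_integral_unique:
  assumes "has_rs_integral f g a b I"
  shows "rs_integral f g a b = I"
  unfolding rs_integral_def
proof (rule the_equality)
  show "has_rs_integral f g a b I" by (rule assms)
  show "J = I" if "has_rs_integral f g a b J" for J
    by (rule has_rs_integral_unique[OF that assms])
qed

lemma has_rs_integral_rs_integral:
  assumes "rs_integrable f g a b"
  shows "has_rs_integral f g a b (rs_integral f g a b)"
proof -
  obtain I where I: "has_rs_integral f g a b I"
    using assms unfolding rs_integrable_def ..
  then show ?thesis
    by (simp only: rs_integral_unique[OF I])
qed

lemma has_rs_integral_add:
  assumes "has_rs_integral f g a b I" "has_rs_integral f' g a b I'"
  shows "has_rs_integral (\<lambda>x. f x + f' x) g a b (I + I')"
  unfolding has_rs_integral_iff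
proof (intro allI impI)
  fix e :: real assume "0 < e"
  then have e: "0 < e / 2" by simp
  obtain d where d: "d > 0" "\<And>p. p tagged_division_of {a..b} \<Longrightarrow> (\<lambda>x. ball x d) fine p \<Longrightarrow>
        \<bar>(\<Sum>(x, K)\<in>p. f x * (g (Sup K) - g (Inf K))) - I\<bar> < e / 2"
    using assms(1)[unfolded has_rs_integral_def, rule_format, OF e] by blast
  obtain d' where d': "d' > 0" "\<And>p. p tagged_division_of {a..b} \<Longrightarrow> (\<lambda>x. ball x d') fine p \<Longrightarrow>
        \<bar>(\<Sum>(x, K)\<in>p. f' x * (g (Sup K) - g (Inf K))) - I'\<bar> < e / 2"
    using assms(2)[unfolded has_rs_integral_def, rule_format, OF e] by blast
  have "\<bar>(\<Sum>(x, K)\<in>p. (f x + f' x) * (g (Sup K) - g (Inf K))) - (I + I')\<bar> \<le> e"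
    if p: "p tagged_division_of {a..b}" "(\<lambda>x. ball x (min d d')) fine p" for p
  proof -
    have "(\<lambda>x. ball x d) fine p" "(\<lambda>x. ball x d') fine p"
      using p(2) unfolding fine_def by fastforce+
    moreover have "(\<Sum>(x, K)\<in>p. (f x + f' x) * (g (Sup K) - g (Inf K)))
        = (\<Sum>(x, K)\<in>p. f x * (g (Sup K) - g (Inf K))) + (\<Sum>(x, K)\<in>p. f' x * (g (Sup K) - g (Inf K)))"
      by (simp add: case_prod_unfold distrib_right sum.distrib)
    ultimately show ?thesis
      using d(2)[OF p(1)] d'(2)[OF p(1)] by linarith
  qed
  then show "\<exists>d>0. \<forall>p. p tagged_division_of {a..b} \<and> (\<lambda>x. ball x d) fine p \<longrightarrow>
      \<bar>(\<Sum>(x, K)\<in>p. (f x + f' x) * (g (Sup K) - g (Inf K))) - (I + I')\<bar> \<le> e"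
    using d(1) d'(1) by (intro exI[of _ "min d d'"]) auto
qed

section \<open>Integration of pointwise germs\<close>

text \<open>The tag-dependent gauge absorbs the fact that the remainder is not uniform in the base
  point.\<close>

lemma has_integral_of_germ:
  fixes \<Phi> A M B :: "real \<Rightarrow> real"
  assumes t: "0 \<le> t"
    and germ: "\<And>s. s \<in> {0..t} \<Longrightarrow>
      (\<lambda>v. \<Phi> v - \<Phi> s - A s * (v - s) - M s * (B v - B s)) \<in> o[at s within {0..t}](\<lambda>v. v - s)"
    and I: "has_rs_integral M B 0 t I"
  shows "(A has_integral \<Phi> t - \<Phi> 0 - I) {0..t}"
  unfolding has_integral_real
proof (intro allI impI)
  fix e :: real assume e: "0 < e"
  \<comment> \<open>The summand 1 keeps the denominator positive when \<open>t = 0\<close>. The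
    error budget \<open>e\<close> is halved between the germ remainders and the Riemann--Stieltjes
    sum.\<close>
  define c where "c = e / (2 * (t + 1))"
  have c: "0 < c" "c * t < e / 2"
    using e t by (simp_all add: c_def divide_simps)
  let ?R = "\<lambda>s v. \<Phi> v - \<Phi> s - A s * (v - s) - M s * (B v - B s)"
  have "\<exists>d>0. \<forall>v\<in>{0..t}. \<bar>v - s\<bar> < d \<longrightarrow> \<bar>?R s v\<bar> \<le> c * \<bar>v - s\<bar>" if "s \<in> {0..t}" for s
  proof -
    from landau_o.smallD[OF germ[OF that] c(1)]
    obtain d where "d > 0" "\<And>v. v \<in> {0..t} \<Longrightarrow> v \<noteq> s \<Longrightarrow> dist v s < d \<Longrightarrow> norm (?R s v) \<le> c * norm (v - s)"
      unfolding eventually_at by blast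
    then show ?thesis
      by (intro exI[of _ d]) (force simp: dist_real_def)
  qed
  then obtain \<delta> where \<delta>: "\<And>s. s \<in> {0..t} \<Longrightarrow> 0 < \<delta> s"
    "\<And>s v. s \<in> {0..t} \<Longrightarrow> v \<in> {0..t} \<Longrightarrow> \<bar>v - s\<bar> < \<delta> s \<Longrightarrow> \<bar>?R s v\<bar> \<le> c * \<bar>v - s\<bar>"
    by metis
  obtain d where d: "d > 0" "\<And>p. p tagged_division_of {0..t} \<Longrightarrow> (\<lambda>x. ball x d) fine p \<Longrightarrow>
        \<bar>(\<Sum>(x, K)\<in>p. M x * (B (Sup K) - B (Inf K))) - I\<bar> < e / 2"
    using I[unfolded has_rs_integral_def, rule_format, of "e / 2"] e by auto
  \<comment> \<open>The radius \<open>d\<close> controls the Riemann--Stieltjes sum and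
    \<open>\<delta> x\<close> the germ at the tag; away from \<open>{0..t}\<close> the radius merely
    has to be positive.\<close>
  define \<gamma> where "\<gamma> x = ball x (if x \<in> {0..t} then min d (\<delta> x) else d)" for x
  have "gauge \<gamma>"
    using \<delta>(1) d(1) by (auto simp: gauge_def \<gamma>_def)
  moreover have "norm ((\<Sum>(x, K)\<in>p. measure lborel K *\<^sub>R A x) - (\<Phi> t - \<Phi> 0 - I)) < e"
    if p: "p tagged_division_of {0..t}" "\<gamma> fine p" for p
  proof -
    have "(\<lambda>x. ball x d) fine p"
      using p(2) unfolding fine_def \<gamma>_def by (fastforce split: if_splits)
    then have 1: "\<bar>(\<Sum>(x, K)\<in>p. M x * (B (Sup K) - B (Inf K))) - I\<bar> < e / 2"
      by (rule d(2)[OF p(1)])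
    have "\<bar>(\<Sum>(x, K)\<in>p. A x * (Sup K - Inf K) + M x * (B (Sup K) - B (Inf K))) - (\<Phi> t - \<Phi> 0)\<bar> \<le> c * (t - 0)"
    proof (rule tagged_division_telescope_le[OF t p, where S = "\<lambda>x u v. A x * (v - u) + M x * (B v - B u)"])
      fix x u v assume x: "0 \<le> u" "u \<le> x" "x \<le> v" "v \<le> t" "{u..v} \<subseteq> \<gamma> x"
      have "u \<in> \<gamma> x" "v \<in> \<gamma> x" "x \<in> {0..t}"
        using x by auto
      then have "\<bar>u - x\<bar> < \<delta> x" "\<bar>v - x\<bar> < \<delta> x"
        by (auto simp: \<gamma>_def dist_real_def)
      then have "\<bar>?R x u\<bar> \<le> c * \<bar>u - x\<bar>" "\<bar>?R x v\<bar> \<le> c * \<bar>v - x\<bar>"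
        using x \<delta>(2)[of x u] \<delta>(2)[of x v] by auto
      \<comment> \<open>The germ is known at the tag only, so the increment over the cell is
        compared through \<open>x\<close>; since \<open>u \<le> x \<le> v\<close>, the two distances
        to the tag add up to \<open>v - u\<close>.\<close>
      then have "\<bar>?R x u - ?R x v\<bar> \<le> c * (v - u)"
        using x by (simp add: algebra_simps)
      then show "\<bar>A x * (v - u) + M x * (B v - B u) - (\<Phi> v - \<Phi> u)\<bar> \<le> c * (v - u)"
        by (simp add: algebra_simps)
    qed
    then have 2: "\<bar>(\<Sum>(x, K)\<in>p. A x * (Sup K - Inf K)) + (\<Sum>(x, K)\<in>p. M x * (B (Sup K) - B (Inf K))) - (\<Phi> t - \<Phi> 0)\<bar> \<le> c * t"
      by (simp add: case_prod_unfold sum.distrib)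
    have "(\<Sum>(x, K)\<in>p. measure lborel K *\<^sub>R A x) = (\<Sum>(x, K)\<in>p. A x * (Sup K - Inf K))"
    proof (rule sum.cong, safe)
      fix x K assume xK: "(x, K) \<in> p"
      obtain u v where "K = {u..v}" "x \<in> K"
        using tagged_division_ofD(2,4)[OF p(1) xK] by auto
      then show "measure lborel K *\<^sub>R A x = A x * (Sup K - Inf K)" by auto
    qed
    then show ?thesis
      using 1 2 c(2) by (simp add: abs_if split: if_splits)
  qed
  ultimately show "\<exists>\<gamma>. gauge \<gamma> \<and> (\<forall>\<D>. \<D> tagged_division_of {0..t} \<and> \<gamma> fine \<D> \<longrightarrow>
      norm ((\<Sum>(x, K)\<in>\<D>. measure lborel K *\<^sub>R A x) - (\<Phi> t - \<Phi> 0 - I)) < e)"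
    by (intro exI[of _ \<gamma>]) simp
qed

section \<open>Differentiation along curves in the embedded Banach space\<close>

text \<open>The Banach--Steinhaus theorem. By Baire, one of the closed sets \<open>C n\<close>
  contains a ball, and differences of points of that ball reach every direction.\<close>

lemma uniform_boundedness:
  fixes L :: "'i \<Rightarrow> 'h::banach \<Rightarrow>\<^sub>L 'b::real_normed_vector"
  assumes "\<And>k. \<exists>M. \<forall>i\<in>A. norm (blinfun_apply (L i) k) \<le> M"
  obtains M where "\<And>i. i \<in> A \<Longrightarrow> norm (L i) \<le> M"
proof -
  define C where "C n = {k. \<forall>i\<in>A. norm (blinfun_apply (L i) k) \<le> real n}" for n
  have "closed (C n)" for n
  proof -
    have "C n = (\<Inter>i\<in>A. {k. norm (blinfun_apply (L i) k) \<le> real n})"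
      by (auto simp: C_def)
    then show ?thesis
      by (auto intro!: closed_INT closed_Collect_le continuous_intros)
  qed
  moreover have "\<Union>(range C) = UNIV"
  proof -
    have "\<exists>n. k \<in> C n" for k
    proof -
      obtain M where M: "\<forall>i\<in>A. norm (blinfun_apply (L i) k) \<le> M"
        using assms by blast
      obtain n where "M \<le> real n"
        using real_arch_simple by blast
      with M show ?thesis
        by (auto simp: C_def intro: order_trans)
    qed
    then show ?thesis by blast
  qed
  moreover have "Met_TC.mcomplete TYPE('h)"
    by (simp add: complete_UNIV)
  ultimately obtain n where "interior (C n) \<noteq> {}"
    using Met_TC.metric_Baire_category_alt[of "range C"] interior_of_topspace[of "euclidean :: 'h topology"]
    by auto
  then obtain y r where r: "r > 0" "ball y r \<subseteq> C n"
    by (auto simp: mem_interior)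
  have "norm (L i) \<le> 4 * n / r" if i: "i \<in> A" for i
  proof (rule norm_blinfun_bound)
    show "0 \<le> 4 * n / r" using r by simp
    fix k
    show "norm (blinfun_apply (L i) k) \<le> 4 * n / r * norm k"
    proof (cases "k = 0")
      case False
      \<comment> \<open>A step of length \<open>r / 2\<close> from the centre in direction
        \<open>k\<close>; both ends satisfy the bound \<open>n\<close>, whence the constant
        \<open>4 * n / r\<close>.\<close>
      define z where "z = y + (r / 2 / norm k) *\<^sub>R k"
      have "z \<in> ball y r" "y \<in> ball y r"
        using r False by (auto simp: z_def dist_norm)
      then have "z \<in> C n" "y \<in> C n"
        using r(2) by blast+
      then have *: "norm (blinfun_apply (L i) z) \<le> n" "norm (blinfun_apply (L i) y) \<le> n"
        using i by (auto simp: C_def)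
      have "(r / 2 / norm k) *\<^sub>R blinfun_apply (L i) k = blinfun_apply (L i) z - blinfun_apply (L i) y"
        by (simp add: z_def blinfun.bilinear_simps)
      from arg_cong[OF this, of norm] have "r / 2 / norm k * norm (blinfun_apply (L i) k)
          = norm (blinfun_apply (L i) z - blinfun_apply (L i) y)"
        using r(1) by simp
      also have "\<dots> \<le> 2 * n"
        using norm_triangle_ineq4[of "blinfun_apply (L i) z" "blinfun_apply (L i) y"] * by linarith
      finally show ?thesis
        using r(1) False by (simp add: field_simps)
    qed simp
  qed
  then show thesis by (rule that)
qed

lemma filterlim_minus_at_0: "filterlim (\<lambda>v. v - s) (at 0) (at (s :: real) within S)"
proof (rule filterlim_atI)
  have "((\<lambda>v. v - s) \<longlongrightarrow> s - s) (at s within S)"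
    by (intro tendsto_intros)
  then show "((\<lambda>v. v - s) \<longlongrightarrow> 0) (at s within S)" by simp
qed (simp add: eventually_at_filter)

text \<open>The images of \<open>{0..T}\<close> under \<open>x\<close> and \<open>k\<close> are
  compact, so the uniform limit on the product of compact sets restricts to the graph of the two
  curves.\<close>

lemma H_derivative_uniform_along:
  assumes unif: "H_derivative_locally_uniform j T F DF w"
    and x: "continuous_on {0..T} x" and k: "continuous_on {0..T} k"
  shows "uniform_limit {0..T}
     (\<lambda>\<epsilon> v. (F v (x v) (w + \<epsilon> *\<^sub>R blinfun_apply j (k v)) - F v (x v) w) / \<epsilon>)
     (\<lambda>v. blinfun_apply (DF v (x v) w) (k v)) (at 0)"
proof (rule uniform_limitI)
  fix e :: real assume e: "0 < e"
  have "compact (x ` {0..T})" "compact (k ` {0..T})"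
    using x k by (auto intro: compact_continuous_image)
  then have "uniform_limit ({0..T} \<times> x ` {0..T} \<times> k ` {0..T})
          (\<lambda>\<epsilon> (t, x, k). (F t x (w + \<epsilon> *\<^sub>R blinfun_apply j k) - F t x w) / \<epsilon>)
          (\<lambda>(t, x, k). blinfun_apply (DF t x w) k) (at 0)"
    using unif unfolding H_derivative_locally_uniform_def by blast
  from uniform_limitD[OF this e]
  show "\<forall>\<^sub>F \<epsilon> in at 0. \<forall>v\<in>{0..T}. dist ((F v (x v) (w + \<epsilon> *\<^sub>R blinfun_apply j (k v)) - F v (x v) w) / \<epsilon>)
      (blinfun_apply (DF v (x v) w) (k v)) < e"
    by eventually_elim force
qed

text \<open>The increment of the curve is \<open>(v - s) *\<^sub>R k v\<close> with \<open>k\<close>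
  continuous. Uniformity in time, space and direction permits setting
  \<open>\<epsilon> = v - s\<close> in the difference quotient although all arguments move with
  \<open>v\<close>; it remains to pass to the limit in the derivatives \<open>L v\<close> applied to
  \<open>k v\<close>.\<close>

lemma H_derivative_along_curve:
  fixes j :: "'h::banach \<Rightarrow>\<^sub>L path"
  assumes unif: "H_derivative_locally_uniform j T F DF w"
    and x: "continuous_on {0..T} x"
    and F: "\<And>k. continuous_on {0..T} (\<lambda>v. F v (x v) (w + blinfun_apply j k))"
    and c: "continuous_on {0..T} c"
    and c': "((\<lambda>v. (c v - c s) /\<^sub>R (v - s)) \<longlongrightarrow> c') (at s within {0..T})" and s: "s \<in> {0..T}"
  shows "(\<lambda>v. F v (x v) (w + blinfun_apply j (c v - c s)) - F v (x v) w
            - blinfun_apply (DF s (x s) w) c' * (v - s)) \<in> o[at s within {0..T}](\<lambda>v. v - s)"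
proof -
  define L where "L v = DF v (x v) w" for v
  \<comment> \<open>For a fixed direction, \<open>L\<close> is a uniform limit of continuous
    difference quotients.\<close>
  have cont_L: "continuous_on {0..T} (\<lambda>v. blinfun_apply (L v) k)" for k
  proof (rule uniform_limit_theorem)
    show "uniform_limit {0..T}
        (\<lambda>\<epsilon> v. (F v (x v) (w + \<epsilon> *\<^sub>R blinfun_apply j k) - F v (x v) w) / \<epsilon>)
        (\<lambda>v. blinfun_apply (L v) k) (at 0)"
      using H_derivative_uniform_along[OF unif x continuous_on_const] by (simp add: L_def)
    have "continuous_on {0..T} (\<lambda>v. (F v (x v) (w + blinfun_apply j (\<epsilon> *\<^sub>R k))
        - F v (x v) (w + blinfun_apply j 0)) / \<epsilon>)" if "\<epsilon> \<noteq> 0" for \<epsilon>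
      using that by (intro continuous_intros F) simp
    then show "\<forall>\<^sub>F \<epsilon> in at 0. continuous_on {0..T}
        (\<lambda>v. (F v (x v) (w + \<epsilon> *\<^sub>R blinfun_apply j k) - F v (x v) w) / \<epsilon>)"
      by (simp add: blinfun.bilinear_simps eventually_at_filter)
  qed simp
  \<comment> \<open>Continuity is known only direction by direction; pointwise boundedness turns
    into a norm bound on \<open>L\<close>, which is what lets the direction vary with
    \<open>v\<close>.\<close>
  have "\<exists>M. \<forall>v\<in>{0..T}. norm (blinfun_apply (L v) k) \<le> M" for k
  proof -
    have "bounded ((\<lambda>v. blinfun_apply (L v) k) ` {0..T})"
      by (intro compact_imp_bounded compact_continuous_image cont_L) simp
    then show ?thesis by (auto simp: bounded_iff)
  qed
  then obtain M where M: "\<And>v. v \<in> {0..T} \<Longrightarrow> norm (L v) \<le> M"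
    using uniform_boundedness[of "{0..T}" L] by blast
  \<comment> \<open>The value \<open>c'\<close> at \<open>s\<close> fills the gap of the difference
    quotient and makes \<open>k\<close> continuous on the whole interval.\<close>
  define k where "k v = (if v = s then c' else (c v - c s) /\<^sub>R (v - s))" for v
  have k_lim: "(k \<longlongrightarrow> c') (at s within {0..T})"
  proof (rule Lim_transform_eventually)
    show "((\<lambda>v. (c v - c s) /\<^sub>R (v - s)) \<longlongrightarrow> c') (at s within {0..T})"
      by (rule c')
  qed (simp add: k_def eventually_at_filter)
  have k: "continuous_on {0..T} k"
    unfolding continuous_on_def
  proof
    fix r assume r: "r \<in> {0..T}"
    show "(k \<longlongrightarrow> k r) (at r within {0..T})"
    proof (cases "r = s")
      case False
      have "((\<lambda>v. (c v - c s) /\<^sub>R (v - s)) \<longlongrightarrow> (c r - c s) /\<^sub>R (r - s)) (at r within {0..T})"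
        using c r False unfolding continuous_on_def by (intro tendsto_intros) auto
      moreover have "\<forall>\<^sub>F v in at r within {0..T}. v \<noteq> s"
        using False by (intro eventually_neq_at_within)
      then have "\<forall>\<^sub>F v in at r within {0..T}. (c v - c s) /\<^sub>R (v - s) = k v"
        by eventually_elim (simp add: k_def)
      ultimately show ?thesis
        using False by (auto simp: k_def intro: Lim_transform_eventually)
    qed (use k_lim in \<open>simp add: k_def\<close>)
  qed
  have ck: "c v - c s = (v - s) *\<^sub>R k v" for v
    by (simp add: k_def)
  let ?q = "\<lambda>\<epsilon> v. (F v (x v) (w + \<epsilon> *\<^sub>R blinfun_apply j (k v)) - F v (x v) w) / \<epsilon>"
  have "((\<lambda>v. ?q (v - s) v - blinfun_apply (L v) (k v)) \<longlongrightarrow> 0) (at s within {0..T})"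
    unfolding tendsto_iff
  proof (intro allI impI)
    fix e :: real assume "0 < e"
    then have "\<forall>\<^sub>F \<epsilon> in at 0. \<forall>v\<in>{0..T}. dist (?q \<epsilon> v) (blinfun_apply (L v) (k v)) < e"
      using uniform_limitD[OF H_derivative_uniform_along[OF unif x k]] by (simp add: L_def)
    from eventually_compose_filterlim[OF this filterlim_minus_at_0[of s "{0..T}"]]
    show "\<forall>\<^sub>F v in at s within {0..T}. dist (?q (v - s) v - blinfun_apply (L v) (k v)) 0 < e"
      unfolding eventually_at_filter by eventually_elim (simp add: dist_real_def)
  qed
  moreover have "((\<lambda>v. blinfun_apply (L v) (k v - c')) \<longlongrightarrow> 0) (at s within {0..T})"
  proof (rule Lim_null_comparison)
    have "norm (blinfun_apply (L v) (k v - c')) \<le> M * norm (k v - c')" if "v \<in> {0..T}" for v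
      using M[OF that] by (intro order_trans[OF norm_blinfun] mult_right_mono) auto
    then show "\<forall>\<^sub>F v in at s within {0..T}. norm (blinfun_apply (L v) (k v - c')) \<le> M * norm (k v - c')"
      by (simp add: eventually_at_filter)
    have "((\<lambda>v. M * norm (k v - c')) \<longlongrightarrow> M * norm (c' - c')) (at s within {0..T})"
      by (intro tendsto_intros k_lim)
    then show "((\<lambda>v. M * norm (k v - c')) \<longlongrightarrow> 0) (at s within {0..T})" by simp
  qed
  moreover have "((\<lambda>v. blinfun_apply (L v) c' - blinfun_apply (L s) c') \<longlongrightarrow> 0) (at s within {0..T})"
    using cont_L[of c'] s by (intro LIM_zero) (auto simp: continuous_on_def)
  \<comment> \<open>Three errors: the quotient against \<open>L v\<close> in direction
    \<open>k v\<close>, the change of direction to \<open>c'\<close>, and the change of operator to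
    \<open>L s\<close>.\<close>
  ultimately have lim: "((\<lambda>v. (?q (v - s) v - blinfun_apply (L v) (k v)) + blinfun_apply (L v) (k v - c')
      + (blinfun_apply (L v) c' - blinfun_apply (L s) c')) \<longlongrightarrow> 0 + 0 + 0) (at s within {0..T})"
    by (intro tendsto_add)
  show ?thesis
  proof (rule smalloI_tendsto)
    show "((\<lambda>v. (F v (x v) (w + blinfun_apply j (c v - c s)) - F v (x v) w
        - blinfun_apply (DF s (x s) w) c' * (v - s)) / (v - s)) \<longlongrightarrow> 0) (at s within {0..T})"
      using lim unfolding add_0_left
    proof (rule Lim_transform_eventually)
      show "\<forall>\<^sub>F v in at s within {0..T}. (?q (v - s) v - blinfun_apply (L v) (k v)) + blinfun_apply (L v) (k v - c')
          + (blinfun_apply (L v) c' - blinfun_apply (L s) c')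
        = (F v (x v) (w + blinfun_apply j (c v - c s)) - F v (x v) w
        - blinfun_apply (DF s (x s) w) c' * (v - s)) / (v - s)"
        by (simp add: eventually_at_filter ck blinfun.bilinear_simps L_def diff_divide_distrib)
    qed
  qed (simp add: eventually_at_filter)
qed

text \<open>Lifting the increments from time 0 through \<open>j\<close> gives a genuine curve
  \<open>c\<close> in the embedded space; injectivity makes the lift of any other increment a
  difference of values of \<open>c\<close>.\<close>

lemma has_H_curve_derivative_primitive:
  fixes j :: "'h::banach \<Rightarrow>\<^sub>L path"
  assumes inj: "inj (blinfun_apply j)" and T: "0 \<le> T"
    and \<Gamma>: "\<And>s. s \<in> {0..T} \<Longrightarrow> has_H_curve_derivative j \<Gamma> (\<Gamma>' s) s {0..T}"
  obtains c where "\<And>s r. s \<in> {0..T} \<Longrightarrow> r \<in> {0..T} \<Longrightarrow> \<Gamma> s = \<Gamma> r + blinfun_apply j (c s - c r)"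
    and "\<And>s. s \<in> {0..T} \<Longrightarrow> ((\<lambda>r. (c r - c s) /\<^sub>R (r - s)) \<longlongrightarrow> \<Gamma>' s) (at s within {0..T})"
    and "continuous_on {0..T} c"
proof
  define c where "c s = inv (blinfun_apply j) (\<Gamma> s - \<Gamma> 0)" for s
  have jc: "\<Gamma> s = \<Gamma> 0 + blinfun_apply j (c s)" if "s \<in> {0..T}" for s
  proof -
    have "\<Gamma> s - \<Gamma> 0 \<in> range (blinfun_apply j)"
      using \<Gamma>[of 0] T that by (auto simp: has_H_curve_derivative_def)
    then show ?thesis
      by (simp add: c_def f_inv_into_f)
  qed
  show inc: "\<Gamma> s = \<Gamma> r + blinfun_apply j (c s - c r)" if "s \<in> {0..T}" "r \<in> {0..T}" for s r
    using jc[OF that(1)] jc[OF that(2)] by (simp add: blinfun.bilinear_simps)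
  show lim: "((\<lambda>r. (c r - c s) /\<^sub>R (r - s)) \<longlongrightarrow> \<Gamma>' s) (at s within {0..T})"
    if s: "s \<in> {0..T}" for s
  proof (rule Lim_transform_eventually)
    show "((\<lambda>r. inv (blinfun_apply j) (\<Gamma> r - \<Gamma> s) /\<^sub>R (r - s)) \<longlongrightarrow> \<Gamma>' s) (at s within {0..T})"
      using \<Gamma>[OF s] by (simp add: has_H_curve_derivative_def)
    have "inv (blinfun_apply j) (\<Gamma> r - \<Gamma> s) = c r - c s" if "r \<in> {0..T}" for r
      using inc[OF that s] inj by simp
    then show "\<forall>\<^sub>F r in at s within {0..T}.
        inv (blinfun_apply j) (\<Gamma> r - \<Gamma> s) /\<^sub>R (r - s) = (c r - c s) /\<^sub>R (r - s)"
      by (simp add: eventually_at_filter)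
  qed
  show "continuous_on {0..T} c"
    unfolding continuous_on_def
  proof
    fix s assume s: "s \<in> {0..T}"
    have "((\<lambda>r. c s + (r - s) *\<^sub>R ((c r - c s) /\<^sub>R (r - s))) \<longlongrightarrow> c s + (s - s) *\<^sub>R \<Gamma>' s) (at s within {0..T})"
      by (intro tendsto_intros lim s)
    moreover have "\<forall>\<^sub>F r in at s within {0..T}. c s + (r - s) *\<^sub>R ((c r - c s) /\<^sub>R (r - s)) = c r"
      by (simp add: eventually_at_filter)
    ultimately show "(c \<longlongrightarrow> c s) (at s within {0..T})"
      using Lim_transform_eventually by fastforce
  qed
qed

section \<open>First-order germs\<close>

lemma abs_powr_smallo:
  fixes s :: real
  assumes "1 < \<theta>"
  shows "(\<lambda>v. \<bar>v - s\<bar> powr \<theta>) \<in> o[at s within S](\<lambda>v. v - s)"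
proof -
  have "(\<lambda>v. \<bar>v - s\<bar> powr \<theta>) \<in> o[at s within S](\<lambda>v. \<bar>v - s\<bar>)"
  proof (rule smalloI_tendsto)
    have "((\<lambda>v. \<bar>v - s\<bar> powr (\<theta> - 1)) \<longlongrightarrow> \<bar>s - s\<bar> powr (\<theta> - 1)) (at s within S)"
      using assms by (intro tendsto_intros) simp_all
    then have "((\<lambda>v. \<bar>v - s\<bar> powr (\<theta> - 1)) \<longlongrightarrow> 0) (at s within S)"
      by simp
    then show "((\<lambda>v. \<bar>v - s\<bar> powr \<theta> / \<bar>v - s\<bar>) \<longlongrightarrow> 0) (at s within S)"
    proof (rule Lim_transform_eventually)
      show "\<forall>\<^sub>F v in at s within S. \<bar>v - s\<bar> powr (\<theta> - 1) = \<bar>v - s\<bar> powr \<theta> / \<bar>v - s\<bar>"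
        by (simp add: eventually_at_filter powr_diff)
    qed
  qed (simp add: eventually_at_filter)
  then show ?thesis by simp
qed

lemma diff_bigo_abs_powr:
  fixes s :: real
  assumes "\<beta> \<le> 1"
  shows "(\<lambda>v. v - s) \<in> O[at s within S](\<lambda>v. \<bar>v - s\<bar> powr \<beta>)"
proof (rule bigoI[where c = 1])
  have "\<bar>v - s\<bar> \<le> \<bar>v - s\<bar> powr \<beta>" if "v \<noteq> s" "\<bar>v - s\<bar> < 1" for v
    using that assms powr_mono'[of \<beta> 1 "\<bar>v - s\<bar>"] by simp
  then show "\<forall>\<^sub>F v in at s within S. norm (v - s) \<le> 1 * norm (\<bar>v - s\<bar> powr \<beta>)"
    unfolding eventually_at by (intro exI[of _ 1]) (auto simp: dist_real_def)
qed

lemma holder_on_bigo: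
  assumes "holder_on \<beta> S f" "s \<in> S"
  shows "(\<lambda>v. f v - f s) \<in> O[at s within S](\<lambda>v. \<bar>v - s\<bar> powr \<beta>)"
proof -
  obtain C where "\<And>u v. u \<in> S \<Longrightarrow> v \<in> S \<Longrightarrow> \<bar>f u - f v\<bar> \<le> C * \<bar>u - v\<bar> powr \<beta>"
    using assms(1) unfolding holder_on_def by blast
  then show ?thesis
    using assms(2) by (intro bigoI[where c = C]) (simp add: eventually_at_filter)
qed

lemma has_real_derivative_smallo:
  assumes "(f has_real_derivative D) (at s within S)"
  shows "(\<lambda>v. f v - f s - D * (v - s)) \<in> o[at s within S](\<lambda>v. v - s)"
proof (rule smalloI_tendsto)
  have "((\<lambda>v. (f v - f s) / (v - s) - D) \<longlongrightarrow> 0) (at s within S)"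
    using assms by (intro LIM_zero) (simp add: has_field_derivative_iff)
  then show "((\<lambda>v. (f v - f s - D * (v - s)) / (v - s)) \<longlongrightarrow> 0) (at s within S)"
  proof (rule Lim_transform_eventually)
    show "\<forall>\<^sub>F v in at s within S. (f v - f s) / (v - s) - D = (f v - f s - D * (v - s)) / (v - s)"
      by (simp add: eventually_at_filter diff_divide_distrib)
  qed
qed (simp add: eventually_at_filter)

text \<open>Moving the tag from the left endpoint to \<open>x\<close> adds
  \<open>(f x - f u) * (g v - g u)\<close>, again of order \<open>\<alpha> + \<beta>\<close>.
  Arbitrary tags are what Riemann--Stieltjes sums require.\<close>

lemma young_bound:
  assumes f: "holder_on \<alpha> {a..b} f" and g: "holder_on \<beta> {a..b} g" and ab: "a \<le> b"
    and \<alpha>: "0 < \<alpha>" and \<beta>: "0 < \<beta>" and \<alpha>\<beta>: "1 < \<alpha> + \<beta>"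
  shows "\<exists>I. \<exists>K\<ge>0. \<forall>x u v. a \<le> u \<and> u \<le> x \<and> x \<le> v \<and> v \<le> b \<longrightarrow>
      \<bar>f x * (g v - g u) - (I v - I u)\<bar> \<le> K * (v - u) powr (\<alpha> + \<beta>)"
proof -
  define cl where "cl s = max a (min b s)" for s
  have cl: "cl s = s" if "s \<in> {a..b}" for s
    using that by (simp add: cl_def)
  obtain A where A: "0 \<le> A" "\<And>s t. s \<in> {a..b} \<Longrightarrow> t \<in> {a..b} \<Longrightarrow> \<bar>f s - f t\<bar> \<le> A * \<bar>s - t\<bar> powr \<alpha>"
    using holder_onE[OF f] by blast
  obtain B where B: "0 \<le> B" "\<And>s t. s \<in> {a..b} \<Longrightarrow> t \<in> {a..b} \<Longrightarrow> \<bar>g s - g t\<bar> \<le> B * \<bar>s - t\<bar> powr \<beta>"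
    using holder_onE[OF g] by blast
  obtain I K where I: "\<And>u v. a \<le> u \<Longrightarrow> u \<le> v \<Longrightarrow>
      \<bar>I v - I u - f (cl u) * (g (cl v) - g (cl u))\<bar> \<le> K * (v - u) powr (\<alpha> + \<beta>)"
    using young_primitive[OF holder_on_clamp[OF f ab less_imp_le[OF \<alpha>]]
        holder_on_clamp[OF g ab less_imp_le[OF \<beta>]] \<alpha> \<beta> \<alpha>\<beta>] unfolding cl_def by blast
  have "\<bar>f x * (g v - g u) - (I v - I u)\<bar> \<le> (A * B + \<bar>K\<bar>) * (v - u) powr (\<alpha> + \<beta>)"
    if x: "a \<le> u" "u \<le> x" "x \<le> v" "v \<le> b" for x u v
  proof -
    have "\<bar>(f x - f u) * (g v - g u)\<bar> \<le> (A * (v - u) powr \<alpha>) * (B * (v - u) powr \<beta>)"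
      unfolding abs_mult
    proof (rule mult_mono)
      show "\<bar>f x - f u\<bar> \<le> A * (v - u) powr \<alpha>"
        using A(1) x \<alpha> by (intro order_trans[OF A(2)] mult_left_mono powr_mono2) auto
      show "\<bar>g v - g u\<bar> \<le> B * (v - u) powr \<beta>"
        using B(1) x \<beta> by (intro order_trans[OF B(2)] mult_left_mono powr_mono2) auto
    qed (use A in auto)
    moreover have "\<bar>I v - I u - f u * (g v - g u)\<bar> \<le> K * (v - u) powr (\<alpha> + \<beta>)"
      using I[of u v] x by (simp add: cl)
    moreover have "K * (v - u) powr (\<alpha> + \<beta>) \<le> \<bar>K\<bar> * (v - u) powr (\<alpha> + \<beta>)"
      by (intro mult_right_mono) auto
    ultimately show ?thesis
      by (simp add: powr_add algebra_simps abs_le_iff)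
  qed
  moreover have "0 \<le> A * B + \<bar>K\<bar>"
    using A(1) B(1) by simp
  ultimately show ?thesis by blast
qed

text \<open>One primitive \<open>I\<close> represents the integrals over all \<open>[0, v]\<close>,
  so the Young estimate applies to their increments. For \<open>v < s\<close> it is used on
  \<open>[v, s]\<close> with the right endpoint as tag.\<close>

lemma young_integral_germ:
  assumes f: "holder_on \<alpha> {0..T} f" and g: "holder_on \<beta> {0..T} g"
    and \<alpha>: "0 < \<alpha>" and \<beta>: "0 < \<beta>" and \<alpha>\<beta>: "1 < \<alpha> + \<beta>" and s: "s \<in> {0..T}"
  shows "(\<lambda>v. rs_integral f g 0 v - rs_integral f g 0 s - f s * (g v - g s))
    \<in> o[at s within {0..T}](\<lambda>v. v - s)"
proof -
  have T: "0 \<le> T" using s by simp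
  obtain I K where K: "0 \<le> K" and I: "\<And>x u v. 0 \<le> u \<Longrightarrow> u \<le> x \<Longrightarrow> x \<le> v \<Longrightarrow> v \<le> T \<Longrightarrow>
      \<bar>f x * (g v - g u) - (I v - I u)\<bar> \<le> K * (v - u) powr (\<alpha> + \<beta>)"
    using young_bound[OF f g T \<alpha> \<beta> \<alpha>\<beta>] by blast
  have rs: "rs_integral f g 0 v = I v - I 0" if "v \<in> {0..T}" for v
  proof (rule rs_integral_unique, rule has_rs_integral_primitive[OF _ \<alpha>\<beta> K])
    show "\<bar>f x * (g y - g u) - (I y - I u)\<bar> \<le> K * (y - u) powr (\<alpha> + \<beta>)"
      if "0 \<le> u" "u \<le> x" "x \<le> y" "y \<le> v" for x u y
      using that \<open>v \<in> {0..T}\<close> by (intro I) auto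
  qed (use that in simp)
  have le: "\<bar>f s * (g v - g s) - (I v - I s)\<bar> \<le> K * \<bar>v - s\<bar> powr (\<alpha> + \<beta>)" if v: "v \<in> {0..T}" for v
  proof (cases "s \<le> v")
    case False
    have "f s * (g v - g s) - (I v - I s) = - (f s * (g s - g v) - (I s - I v))"
      by (simp add: algebra_simps)
    then show ?thesis
      using I[of v s s] v s False by (simp only: abs_minus_cancel) auto
  qed (use I[of s s v] v s in auto)
  have "\<bar>rs_integral f g 0 v - rs_integral f g 0 s - f s * (g v - g s)\<bar> \<le> K * \<bar>v - s\<bar> powr (\<alpha> + \<beta>)"
    if v: "v \<in> {0..T}" for v
  proof -
    have "rs_integral f g 0 v - rs_integral f g 0 s - f s * (g v - g s)
        = - (f s * (g v - g s) - (I v - I s))"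
      unfolding rs[OF v] rs[OF s] by simp
    then show ?thesis
      using le[OF v] by (simp only: abs_minus_cancel)
  qed
  then have "(\<lambda>v. rs_integral f g 0 v - rs_integral f g 0 s - f s * (g v - g s))
      \<in> O[at s within {0..T}](\<lambda>v. \<bar>v - s\<bar> powr (\<alpha> + \<beta>))"
    by (intro bigoI[where c = K]) (simp add: eventually_at_filter)
  then show ?thesis
    using abs_powr_smallo[OF \<alpha>\<beta>] by (rule landau_o.big_small_trans)
qed

lemma lipschitz_compose_continuous_on:
  fixes F :: "real \<Rightarrow> real \<Rightarrow> real"
  assumes F: "\<And>x. continuous_on S (\<lambda>v. F v x)"
    and L: "\<And>v. v \<in> S \<Longrightarrow> L-lipschitz_on UNIV (F v)"
    and x: "continuous_on S x"
  shows "continuous_on S (\<lambda>v. F v (x v))"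
  unfolding continuous_on_def
proof
  fix s assume s: "s \<in> S"
  have "((\<lambda>v. F v (x v) - F v (x s)) \<longlongrightarrow> 0) (at s within S)"
  proof (rule Lim_null_comparison)
    show "\<forall>\<^sub>F v in at s within S. norm (F v (x v) - F v (x s)) \<le> L * \<bar>x v - x s\<bar>"
      using lipschitz_onD[OF L] by (simp add: eventually_at_filter dist_real_def)
    have "((\<lambda>v. L * \<bar>x v - x s\<bar>) \<longlongrightarrow> L * \<bar>x s - x s\<bar>) (at s within S)"
      using x s by (intro tendsto_intros) (simp add: continuous_on_def)
    then show "((\<lambda>v. L * \<bar>x v - x s\<bar>) \<longlongrightarrow> 0) (at s within S)" by simp
  qed
  moreover have "((\<lambda>v. F v (x s)) \<longlongrightarrow> F s (x s)) (at s within S)"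
    using F s by (simp add: continuous_on_def)
  ultimately have "((\<lambda>v. (F v (x v) - F v (x s)) + F v (x s)) \<longlongrightarrow> 0 + F s (x s)) (at s within S)"
    by (rule tendsto_add)
  then show "((\<lambda>v. F v (x v)) \<longlongrightarrow> F s (x s)) (at s within S)" by simp
qed

text \<open>The quadratic Taylor remainder is negligible because \<open>x\<close> is Hoelder continuous at \<open>s\<close> of
  exponent greater than \<open>1/2\<close>.\<close>

lemma chain_germ:
  fixes F Fx :: "real \<Rightarrow> real \<Rightarrow> real"
  assumes s: "s \<in> S"
    and deriv: "\<And>v y. v \<in> S \<Longrightarrow> (F v has_real_derivative Fx v y) (at y)"
    and L: "\<And>v. v \<in> S \<Longrightarrow> L-lipschitz_on UNIV (Fx v)"
    and Fx: "holder_on \<alpha> S (\<lambda>v. Fx v (x s))"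
    and \<beta>: "1/2 < \<beta>" "1 < \<alpha> + \<beta>"
    and xO: "(\<lambda>v. x v - x s) \<in> O[at s within S](\<lambda>v. \<bar>v - s\<bar> powr \<beta>)"
    and xo: "(\<lambda>v. x v - x s - D v) \<in> o[at s within S](\<lambda>v. v - s)"
    and Fo: "(\<lambda>v. F v (x s) - F s (x s) - E v) \<in> o[at s within S](\<lambda>v. v - s)"
  shows "(\<lambda>v. F v (x v) - F s (x s) - E v - Fx s (x s) * D v) \<in> o[at s within S](\<lambda>v. v - s)"
proof -
  \<comment> \<open>Mean value theorem in space at the fixed time \<open>v\<close>; the Lipschitz
    bound on \<open>Fx\<close> replaces a second derivative.\<close>
  have "(\<lambda>v. F v (x v) - F v (x s) - Fx v (x s) * (x v - x s))
      \<in> O[at s within S](\<lambda>v. (x v - x s) * (x v - x s))"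
  proof (rule bigoI[where c = L])
    have "\<bar>F v (x v) - F v (x s) - Fx v (x s) * (x v - x s)\<bar> \<le> L * \<bar>(x v - x s) * (x v - x s)\<bar>"
      if v: "v \<in> S" for v
    proof -
      obtain z where z: "\<bar>z - x s\<bar> \<le> \<bar>x v - x s\<bar>" "F v (x v) - F v (x s) = (x v - x s) * Fx v z"
      proof (cases "x v" "x s" rule: linorder_cases)
        case less
        obtain z where "x v < z" "z < x s" "F v (x s) - F v (x v) = (x s - x v) * Fx v z"
          using MVT2[OF less deriv[OF v]] by blast
        then show ?thesis
          using that[of z] by (simp add: algebra_simps)
      next
        case greater
        obtain z where "x s < z" "z < x v" "F v (x v) - F v (x s) = (x v - x s) * Fx v z"
          using MVT2[OF greater deriv[OF v]] by blast
        then show ?thesis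
          using that[of z] by simp
      qed (use that[of "x s"] in simp)
      have "F v (x v) - F v (x s) - Fx v (x s) * (x v - x s) = (Fx v z - Fx v (x s)) * (x v - x s)"
        by (simp add: z(2) algebra_simps)
      also have "\<bar>\<dots>\<bar> \<le> (L * \<bar>x v - x s\<bar>) * \<bar>x v - x s\<bar>"
        unfolding abs_mult
      proof (rule mult_right_mono)
        have "\<bar>Fx v z - Fx v (x s)\<bar> \<le> L * \<bar>z - x s\<bar>"
          using lipschitz_onD[OF L[OF v], of z "x s"] by (simp add: dist_real_def)
        also have "\<dots> \<le> L * \<bar>x v - x s\<bar>"
          using z(1) lipschitz_on_nonneg[OF L[OF v]] by (rule mult_left_mono)
        finally show "\<bar>Fx v z - Fx v (x s)\<bar> \<le> L * \<bar>x v - x s\<bar>" .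
      qed simp
      finally show ?thesis by (simp add: abs_mult mult.assoc)
    qed
    then show "\<forall>\<^sub>F v in at s within S. norm (F v (x v) - F v (x s) - Fx v (x s) * (x v - x s))
        \<le> L * norm ((x v - x s) * (x v - x s))"
      by (simp add: eventually_at_filter)
  qed
  also have "(\<lambda>v. (x v - x s) * (x v - x s)) \<in> O[at s within S](\<lambda>v. \<bar>v - s\<bar> powr \<beta> * \<bar>v - s\<bar> powr \<beta>)"
    by (intro landau_o.big.mult xO)
  also have "(\<lambda>v. \<bar>v - s\<bar> powr \<beta> * \<bar>v - s\<bar> powr \<beta>) \<in> o[at s within S](\<lambda>v. v - s)"
    using abs_powr_smallo[of "\<beta> + \<beta>" s S] \<beta> by (simp only: powr_add)
  finally have 1: "(\<lambda>v. F v (x v) - F v (x s) - Fx v (x s) * (x v - x s)) \<in> o[at s within S](\<lambda>v. v - s)" .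
  \<comment> \<open>Moving the derivative from time \<open>v\<close> back to \<open>s\<close> leaves
    a product of two Hoelder increments, of order \<open>\<alpha> + \<beta> > 1\<close>.\<close>
  have "(\<lambda>v. (Fx v (x s) - Fx s (x s)) * (x v - x s))
      \<in> O[at s within S](\<lambda>v. \<bar>v - s\<bar> powr \<alpha> * \<bar>v - s\<bar> powr \<beta>)"
    by (intro landau_o.big.mult xO holder_on_bigo[OF Fx s])
  also have "(\<lambda>v. \<bar>v - s\<bar> powr \<alpha> * \<bar>v - s\<bar> powr \<beta>) \<in> o[at s within S](\<lambda>v. v - s)"
    using abs_powr_smallo[of "\<alpha> + \<beta>" s S] \<beta> by (simp only: powr_add)
  finally have 2: "(\<lambda>v. (Fx v (x s) - Fx s (x s)) * (x v - x s)) \<in> o[at s within S](\<lambda>v. v - s)" .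
  have 3: "(\<lambda>v. Fx s (x s) * (x v - x s - D v)) \<in> o[at s within S](\<lambda>v. v - s)"
    using xo by simp
  from sum_in_smallo(1)[OF sum_in_smallo(1)[OF 1 2] sum_in_smallo(1)[OF 3 Fo]]
  show ?thesis
    by (rule landau_o.small.in_cong[THEN iffD1, rotated]) (simp add: algebra_simps)
qed

section \<open>Hoelder paths and primitives\<close>

lemma holder_on_add:
  assumes "holder_on \<beta> S f" "holder_on \<beta> S g"
  shows "holder_on \<beta> S (\<lambda>s. f s + g s)"
proof -
  obtain C D where C: "\<And>s t. s \<in> S \<Longrightarrow> t \<in> S \<Longrightarrow> \<bar>f s - f t\<bar> \<le> C * \<bar>s - t\<bar> powr \<beta>"
    and D: "\<And>s t. s \<in> S \<Longrightarrow> t \<in> S \<Longrightarrow> \<bar>g s - g t\<bar> \<le> D * \<bar>s - t\<bar> powr \<beta>"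
    using assms unfolding holder_on_def by blast
  have "\<bar>f s + g s - (f t + g t)\<bar> \<le> (C + D) * \<bar>s - t\<bar> powr \<beta>" if "s \<in> S" "t \<in> S" for s t
    using C[OF that] D[OF that] by (simp add: distrib_right)
  then show ?thesis
    unfolding holder_on_def by blast
qed

lemma holder_on_cong:
  assumes "\<And>s. s \<in> S \<Longrightarrow> f s = g s"
  shows "holder_on \<beta> S f \<longleftrightarrow> holder_on \<beta> S g"
  using assms unfolding holder_on_def by simp

text \<open>The primitive of a bounded function is Lipschitz, and on \<open>[0, T]\<close> a
  distance is at most \<open>T powr (1 - \<beta>)\<close> times its power
  \<open>\<beta>\<close>.\<close>

lemma holder_on_integral:
  assumes h: "continuous_on {0..T} h" and \<beta>: "0 \<le> \<beta>" "\<beta> \<le> 1"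
  shows "holder_on \<beta> {0..T} (\<lambda>s. integral {0..s} h)"
proof -
  have "bounded (h ` {0..T})"
    using h by (intro compact_imp_bounded compact_continuous_image) auto
  then obtain M where M: "\<And>u. u \<in> {0..T} \<Longrightarrow> norm (h u) \<le> M"
    unfolding bounded_iff by blast
  have int: "h integrable_on {0..s}" if "s \<in> {0..T}" for s
    using that by (intro integrable_continuous_real continuous_on_subset[OF h]) auto
  have le: "\<bar>integral {0..t} h - integral {0..s} h\<bar> \<le> (M * T powr (1 - \<beta>)) * \<bar>t - s\<bar> powr \<beta>"
    if st: "s \<in> {0..T}" "t \<in> {0..T}" "s \<le> t" for s t
  proof -
    have "integral {0..t} h - integral {0..s} h = integral {s..t} h"
      using Henstock_Kurzweil_Integration.integral_combine[of 0 s t h] int[OF st(2)] st by simp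
    also have "\<bar>\<dots>\<bar> \<le> M * (t - s)"
      using integral_bound[of s t h M] M st continuous_on_subset[OF h, of "{s..t}"] by auto
    also have "t - s = (t - s) powr (1 - \<beta>) * (t - s) powr \<beta>"
      using st by (simp flip: powr_add)
    also have "M * \<dots> \<le> M * (T powr (1 - \<beta>) * (t - s) powr \<beta>)"
      using st \<beta> order_trans[OF norm_ge_zero M[OF st(1)]]
      by (intro mult_left_mono mult_right_mono powr_mono2) auto
    finally show ?thesis using st by (simp add: mult.assoc)
  qed
  have "\<bar>integral {0..s} h - integral {0..t} h\<bar> \<le> (M * T powr (1 - \<beta>)) * \<bar>s - t\<bar> powr \<beta>"
    if "s \<in> {0..T}" "t \<in> {0..T}" for s t
    using le[OF that] le[OF that(2,1)] by (cases "s \<le> t") (simp_all add: abs_minus_commute)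
  then show ?thesis
    unfolding holder_on_def by blast
qed

lemma holder_paths_add:
  assumes "w \<in> holder_paths T H" "w' \<in> holder_paths T H"
  shows "w + w' \<in> holder_paths T H"
  using assms by (simp add: holder_paths_def paths_def holder_on_add)

lemma holder_pathsI_integral:
  assumes w: "w \<in> holder_paths T H" and H: "H \<le> 1" and w': "w' \<in> paths T"
    and h: "continuous_on {0..T} h"
    and eq: "\<And>r. r \<in> {0..T} \<Longrightarrow> apply_bcontfun w' r = apply_bcontfun w r + integral {0..r} h"
  shows "w' \<in> holder_paths T H"
proof -
  have "holder_on \<beta> {0..T} (apply_bcontfun w')" if "0 < \<beta>" "\<beta> < H" for \<beta>
  proof -
    have "holder_on \<beta> {0..T} (\<lambda>r. apply_bcontfun w r + integral {0..r} h)"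
      using w that H by (intro holder_on_add holder_on_integral h) (auto simp: holder_paths_def)
    then show ?thesis
      by (rule holder_on_cong[THEN iffD2, rotated]) (rule eq)
  qed
  then show ?thesis
    using w' by (simp add: holder_paths_def)
qed

text \<open>The fundamental theorem of calculus for the \<open>ds\<close> part and the Young
  estimate for the other. It serves both \<open>G\<close> and the field \<open>F\<close> at a frozen
  space point and path.\<close>

lemma primitive_germ:
  assumes \<phi>: "\<And>v. v \<in> {0..T} \<Longrightarrow> \<phi> v = a + integral {0..v} p + rs_integral q g 0 v"
    and p: "continuous_on {0..T} p"
    and q: "holder_on \<alpha> {0..T} q" and g: "holder_on \<beta> {0..T} g"
    and \<alpha>: "0 < \<alpha>" and \<beta>: "0 < \<beta>" and \<alpha>\<beta>: "1 < \<alpha> + \<beta>" and s: "s \<in> {0..T}"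
  shows "(\<lambda>v. \<phi> v - \<phi> s - (p s * (v - s) + q s * (g v - g s))) \<in> o[at s within {0..T}](\<lambda>v. v - s)"
proof -
  have "(\<lambda>v. (integral {0..v} p - integral {0..s} p - p s * (v - s))
      + (rs_integral q g 0 v - rs_integral q g 0 s - q s * (g v - g s)))
      \<in> o[at s within {0..T}](\<lambda>v. v - s)" (is "?f \<in> _")
    by (intro sum_in_smallo young_integral_germ[OF q g \<alpha> \<beta> \<alpha>\<beta> s]
        has_real_derivative_smallo integral_has_real_derivative p s)
  moreover have "\<forall>\<^sub>F v in at s within {0..T}.
      ?f v = \<phi> v - \<phi> s - (p s * (v - s) + q s * (g v - g s))"
    using \<phi> s by (simp add: eventually_at_filter)
  ultimately show ?thesis
    by (simp only: landau_o.small.in_cong)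
qed

section \<open>The formula\<close>

theorem theorem3p2:
  fixes T H :: real
    and P :: "path measure"
    and j :: "'h::banach \<Rightarrow>\<^sub>L path"
    and \<Omega> :: "path set"
    and \<eta> :: "real \<Rightarrow> path \<Rightarrow> real" and \<xi> :: "path \<Rightarrow> real"
    and f0 f1 :: "real \<Rightarrow> real \<Rightarrow> path \<Rightarrow> real"
    and g0 g1 :: "real \<Rightarrow> path \<Rightarrow> real"
    and F Fx :: "real \<Rightarrow> real \<Rightarrow> path \<Rightarrow> real"
    and DF :: "real \<Rightarrow> real \<Rightarrow> path \<Rightarrow> 'h \<Rightarrow>\<^sub>L real"
    and G :: "real \<Rightarrow> path \<Rightarrow> real"
    and h :: "real \<Rightarrow> real \<Rightarrow> path \<Rightarrow> real"
    and \<Gamma> :: "real \<Rightarrow> path \<Rightarrow> path" and \<Gamma>' :: "real \<Rightarrow> path \<Rightarrow> 'h"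
    and t :: real and \<omega> :: path
  assumes T: "0 < T" and H: "1/2 < H" "H < 1"
    and fbm: "fbm_law T H P"
    and \<Omega>: "\<Omega> = holder_paths T H"
    and embedding: "inj (blinfun_apply j)" "range (blinfun_apply j) \<subseteq> \<Omega>"
    \<comment> \<open>measurability of the data\<close>
    and \<eta>_meas: "(\<lambda>(x, w). \<eta> x w) \<in> borel_measurable (borel \<Otimes>\<^sub>M restrict_space borel \<Omega>)"
    and \<xi>_meas: "\<xi> \<in> borel_measurable (restrict_space borel \<Omega>)"
    and f0_meas: "(\<lambda>(s, x, w). f0 s x w) \<in> borel_measurable
          (restrict_space borel {0..T} \<Otimes>\<^sub>M borel \<Otimes>\<^sub>M restrict_space borel \<Omega>)"
    and f1_meas: "(\<lambda>(s, x, w). f1 s x w) \<in> borel_measurable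
          (restrict_space borel {0..T} \<Otimes>\<^sub>M borel \<Otimes>\<^sub>M restrict_space borel \<Omega>)"
    and g0_meas: "(\<lambda>(s, w). g0 s w) \<in> borel_measurable
          (restrict_space borel {0..T} \<Otimes>\<^sub>M restrict_space borel \<Omega>)"
    and g1_meas: "(\<lambda>(s, w). g1 s w) \<in> borel_measurable
          (restrict_space borel {0..T} \<Otimes>\<^sub>M restrict_space borel \<Omega>)"
    \<comment> \<open>regularity of the data\<close>
    and f0_cont: "\<And>x w. w \<in> \<Omega> \<Longrightarrow> continuous_on {0..T} (\<lambda>s. f0 s x w)"
    and g0_cont: "\<And>w. w \<in> \<Omega> \<Longrightarrow> continuous_on {0..T} (\<lambda>s. g0 s w)"
    and f1_holder: "\<And>x w. w \<in> \<Omega> \<Longrightarrow> \<exists>\<alpha>>1 - H. holder_on \<alpha> {0..T} (\<lambda>s. f1 s x w)"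
    and g1_holder: "\<And>w. w \<in> \<Omega> \<Longrightarrow> \<exists>\<alpha>>1 - H. holder_on \<alpha> {0..T} (\<lambda>s. g1 s w)"
    and f1_lipschitz:
      "\<And>w. w \<in> \<Omega> \<Longrightarrow> \<exists>L. \<forall>s\<in>{0..T}. L-lipschitz_on UNIV (\<lambda>x. f1 s x w)"
    \<comment> \<open>the random field and the process\<close>
    and F_eq: "\<And>s x w. s \<in> {0..T} \<Longrightarrow> w \<in> \<Omega> \<Longrightarrow>
          F s x w = \<eta> x w + integral {0..s} (\<lambda>r. f0 r x w)
                    + rs_integral (\<lambda>r. f1 r x w) (apply_bcontfun w) 0 s"
    and G_eq: "\<And>s w. s \<in> {0..T} \<Longrightarrow> w \<in> \<Omega> \<Longrightarrow>
          G s w = \<xi> w + integral {0..s} (\<lambda>r. g0 r w)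
                  + rs_integral (\<lambda>r. g1 r w) (apply_bcontfun w) 0 s"
    \<comment> \<open>regularity of the random field\<close>
    and Fx: "\<And>s x w. s \<in> {0..T} \<Longrightarrow> w \<in> \<Omega> \<Longrightarrow>
          ((\<lambda>y. F s y w) has_real_derivative Fx s x w) (at x)"
    and F_holder: "\<And>x w. w \<in> \<Omega> \<Longrightarrow> \<exists>\<alpha>>1 - H. holder_on \<alpha> {0..T} (\<lambda>s. F s x w)"
    and Fx_holder: "\<And>x w. w \<in> \<Omega> \<Longrightarrow> \<exists>\<alpha>>1 - H. holder_on \<alpha> {0..T} (\<lambda>s. Fx s x w)"
    and F_lipschitz:
      "\<And>w. w \<in> \<Omega> \<Longrightarrow> \<exists>L. \<forall>s\<in>{0..T}. L-lipschitz_on UNIV (\<lambda>x. F s x w)"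
    and Fx_lipschitz:
      "\<And>w. w \<in> \<Omega> \<Longrightarrow> \<exists>L. \<forall>s\<in>{0..T}. L-lipschitz_on UNIV (\<lambda>x. Fx s x w)"
    and DF: "\<And>s x w. s \<in> {0..T} \<Longrightarrow> w \<in> \<Omega> \<Longrightarrow> has_H_derivative j (F s x) (DF s x w) w"
    and DFx: "\<And>s x. s \<in> {0..T} \<Longrightarrow> H_differentiable_on j \<Omega> (Fx s x)"
    and DF_uniform: "\<And>w. w \<in> \<Omega> \<Longrightarrow> H_derivative_locally_uniform j T F DF w"
    \<comment> \<open>the moving path\<close>
    and h_cont_t: "\<And>u w. u \<in> {0..T} \<Longrightarrow> w \<in> \<Omega> \<Longrightarrow> continuous_on {0..T} (\<lambda>s. h s u w)"
    and h_cont_u: "\<And>s w. s \<in> {0..T} \<Longrightarrow> w \<in> \<Omega> \<Longrightarrow> continuous_on {0..T} (\<lambda>u. h s u w)"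
    and \<Gamma>_path: "\<And>s w. s \<in> {0..T} \<Longrightarrow> w \<in> \<Omega> \<Longrightarrow> \<Gamma> s w \<in> paths T"
    and \<Gamma>_eq: "\<And>s r w. s \<in> {0..T} \<Longrightarrow> r \<in> {0..T} \<Longrightarrow> w \<in> \<Omega> \<Longrightarrow>
          apply_bcontfun (\<Gamma> s w) r = apply_bcontfun w r + integral {0..r} (\<lambda>u. h s u w)"
    and \<Gamma>_deriv: "\<And>s w. s \<in> {0..T} \<Longrightarrow> w \<in> \<Omega> \<Longrightarrow>
          has_H_curve_derivative j (\<lambda>r. \<Gamma> r w) (\<Gamma>' s w) s {0..T}"
    and \<Gamma>'_cont: "\<And>w. w \<in> \<Omega> \<Longrightarrow> continuous_on {0..T} (\<lambda>s. \<Gamma>' s w)"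
    \<comment> \<open>time and path at which the formula is asserted\<close>
    and t: "t \<in> {0..T}" and \<omega>: "\<omega> \<in> \<Omega>"
    \<comment> \<open>the integrals on the right-hand side exist (for the last one this is part of the conclusion)\<close>
    and int_f0: "(\<lambda>s. f0 s (G s \<omega>) (\<Gamma> s \<omega>)) integrable_on {0..t}"
    and int_f1: "rs_integrable (\<lambda>s. f1 s (G s \<omega>) (\<Gamma> s \<omega>)) (apply_bcontfun \<omega>) 0 t"
    and int_f1h: "(\<lambda>s. f1 s (G s \<omega>) (\<Gamma> s \<omega>) * h s s \<omega>) integrable_on {0..t}"
    and int_Fx_g0: "(\<lambda>s. Fx s (G s \<omega>) (\<Gamma> s \<omega>) * g0 s \<omega>) integrable_on {0..t}"
    and int_Fx_g1:
      "rs_integrable (\<lambda>s. Fx s (G s \<omega>) (\<Gamma> s \<omega>) * g1 s \<omega>) (apply_bcontfun \<omega>) 0 t"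
  shows "(\<lambda>s. blinfun_apply (DF s (G s \<omega>) (\<Gamma> s \<omega>)) (\<Gamma>' s \<omega>)) integrable_on {0..t} \<and>
         F t (G t \<omega>) (\<Gamma> t \<omega>) =
           F 0 (G 0 \<omega>) (\<Gamma> 0 \<omega>)
         + integral {0..t} (\<lambda>s. f0 s (G s \<omega>) (\<Gamma> s \<omega>))
         + rs_integral (\<lambda>s. f1 s (G s \<omega>) (\<Gamma> s \<omega>)) (apply_bcontfun \<omega>) 0 t
         + integral {0..t} (\<lambda>s. f1 s (G s \<omega>) (\<Gamma> s \<omega>) * h s s \<omega>)
         + integral {0..t} (\<lambda>s. Fx s (G s \<omega>) (\<Gamma> s \<omega>) * g0 s \<omega>)
         + rs_integral (\<lambda>s. Fx s (G s \<omega>) (\<Gamma> s \<omega>) * g1 s \<omega>) (apply_bcontfun \<omega>) 0 t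
         + integral {0..t} (\<lambda>s. blinfun_apply (DF s (G s \<omega>) (\<Gamma> s \<omega>)) (\<Gamma>' s \<omega>))"
proof -

  \<comment> \<open>Stability of the path set and choice of exponents\<close>
  define B where "B = apply_bcontfun \<omega>"
  define x where "x s = G s \<omega>" for s
  have \<omega>': "\<omega> \<in> holder_paths T H" using \<omega> \<Omega> by simp
  have \<Gamma>_mem: "\<Gamma> s \<omega> \<in> \<Omega>" if "s \<in> {0..T}" for s
    unfolding \<Omega> using H by (intro holder_pathsI_integral[OF \<omega>' _ \<Gamma>_path h_cont_u \<Gamma>_eq] that \<omega>) auto
  have add_mem: "w + blinfun_apply j k \<in> \<Omega>" if "w \<in> \<Omega>" for w k
    using that embedding(2) unfolding \<Omega> by (blast intro: holder_paths_add)
  have holder: "holder_on \<beta> {0..T} (apply_bcontfun w)" if "w \<in> \<Omega>" "0 < \<beta>" "\<beta> < H" for w \<beta>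
    using that unfolding \<Omega> holder_paths_def by blast
  have exponent: "\<exists>\<beta>>1/2. \<beta> < H \<and> 1 < \<alpha> + \<beta>" if \<alpha>: "1 - H < \<alpha>" for \<alpha>
  proof -
    \<comment> \<open>\<open>m\<close> is the larger of the two lower bounds for
      \<open>\<beta>\<close>; the midpoint of \<open>m\<close> and \<open>H\<close> lies strictly
      between them.\<close>
    obtain m where "1/2 \<le> m" "1 - \<alpha> \<le> m" "m < H"
      using \<alpha> H by (intro that[of "max (1/2) (1 - \<alpha>)"]) auto
    then show ?thesis
      by (intro exI[of _ "(m + H) / 2"] conjI) (simp_all add: field_simps)
  qed
  have \<alpha>_pos: "0 < \<alpha>" if "1 - H < \<alpha>" for \<alpha>
    using that H by simp

  \<comment> \<open>First-order expansion and continuity of \<open>G\<close> along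
    \<open>\<omega>\<close>\<close>
  define D where "D s v = g0 s \<omega> * (v - s) + g1 s \<omega> * (B v - B s)" for s v
  have x_germ: "(\<lambda>v. x v - x s - D s v) \<in> o[at s within {0..T}](\<lambda>v. v - s)"
    if s: "s \<in> {0..T}" for s
  proof -
    obtain \<alpha> where \<alpha>: "1 - H < \<alpha>" "holder_on \<alpha> {0..T} (\<lambda>s. g1 s \<omega>)"
      using g1_holder[OF \<omega>] by blast
    obtain \<beta> where \<beta>: "1/2 < \<beta>" "\<beta> < H" "1 < \<alpha> + \<beta>"
      using exponent[OF \<alpha>(1)] by blast
    have "0 < \<beta>" using \<beta> by simp
    then show ?thesis
      unfolding D_def x_def B_def
      by (intro primitive_germ[OF G_eq[OF _ \<omega>] g0_cont[OF \<omega>] \<alpha>(2) holder[OF \<omega> _ \<beta>(2)] \<alpha>_pos[OF \<alpha>(1)] _ \<beta>(3) s])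
  qed
  \<comment> \<open>The Hoelder bound at \<open>s\<close> is read off the expansion: the linear term
    and the remainder are no larger than the increment bound for \<open>B\<close>, since
    \<open>\<beta> < 1\<close>.\<close>
  have x_bigo: "(\<lambda>v. x v - x s) \<in> O[at s within {0..T}](\<lambda>v. \<bar>v - s\<bar> powr \<beta>)"
    if s: "s \<in> {0..T}" and \<beta>: "0 < \<beta>" "\<beta> < H" for s \<beta>
  proof -
    have lin: "(\<lambda>v. v - s) \<in> O[at s within {0..T}](\<lambda>v. \<bar>v - s\<bar> powr \<beta>)"
      using \<beta> H by (intro diff_bigo_abs_powr) simp
    have B: "(\<lambda>v. B v - B s) \<in> O[at s within {0..T}](\<lambda>v. \<bar>v - s\<bar> powr \<beta>)"
      unfolding B_def by (intro holder_on_bigo holder \<omega> \<beta> s)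
    have "(\<lambda>v. x v - x s - D s v) \<in> O[at s within {0..T}](\<lambda>v. \<bar>v - s\<bar> powr \<beta>)"
      using landau_o.small_big_trans[OF x_germ[OF s] lin] by (rule landau_o.small_imp_big)
    moreover have "(\<lambda>v. D s v) \<in> O[at s within {0..T}](\<lambda>v. \<bar>v - s\<bar> powr \<beta>)"
      unfolding D_def using lin B by (intro sum_in_bigo) simp_all
    ultimately have "(\<lambda>v. (x v - x s - D s v) + D s v) \<in> O[at s within {0..T}](\<lambda>v. \<bar>v - s\<bar> powr \<beta>)"
      by (rule sum_in_bigo)
    then show ?thesis by simp
  qed
  have x_cont: "continuous_on {0..T} x"
    unfolding continuous_on_def
  proof
    fix s assume s: "s \<in> {0..T}"
    have "((\<lambda>v. \<bar>v - s\<bar> powr (1/2)) \<longlongrightarrow> \<bar>s - s\<bar> powr (1/2)) (at s within {0..T})"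
      by (intro tendsto_intros) simp_all
    then have "(\<lambda>v. \<bar>v - s\<bar> powr (1/2)) \<in> o[at s within {0..T}](\<lambda>_. 1 :: real)"
      by (intro smalloI_tendsto) simp_all
    then have "(\<lambda>v. x v - x s) \<in> o[at s within {0..T}](\<lambda>_. 1 :: real)"
      using H by (intro landau_o.big_small_trans[OF x_bigo[OF s]]) auto
    from smalloD_tendsto[OF this] show "(x \<longlongrightarrow> x s) (at s within {0..T})"
      by (simp add: LIM_zero_iff)
  qed

  \<comment> \<open>Lift of the moving path to the embedded space\<close>
  obtain c where c: "\<And>s r. s \<in> {0..T} \<Longrightarrow> r \<in> {0..T} \<Longrightarrow> \<Gamma> s \<omega> = \<Gamma> r \<omega> + blinfun_apply j (c s - c r)"
    and c': "\<And>s. s \<in> {0..T} \<Longrightarrow> ((\<lambda>r. (c r - c s) /\<^sub>R (r - s)) \<longlongrightarrow> \<Gamma>' s \<omega>) (at s within {0..T})"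
    and c_cont: "continuous_on {0..T} c"
    using has_H_curve_derivative_primitive[OF embedding(1) less_imp_le[OF T] \<Gamma>_deriv[OF _ \<omega>]] by blast

  define A where "A s = f0 s (x s) (\<Gamma> s \<omega>) + f1 s (x s) (\<Gamma> s \<omega>) * h s s \<omega>
    + Fx s (x s) (\<Gamma> s \<omega>) * g0 s \<omega> + blinfun_apply (DF s (x s) (\<Gamma> s \<omega>)) (\<Gamma>' s \<omega>)" for s
  define M where "M s = f1 s (x s) (\<Gamma> s \<omega>) + Fx s (x s) (\<Gamma> s \<omega>) * g1 s \<omega>" for s
  define \<Phi> where "\<Phi> s = F s (x s) (\<Gamma> s \<omega>)" for s

  \<comment> \<open>Expansion of \<open>\<Phi>\<close> at a fixed time\<close>
  have germ: "(\<lambda>v. \<Phi> v - \<Phi> s - A s * (v - s) - M s * (B v - B s)) \<in> o[at s within {0..T}](\<lambda>v. v - s)"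
    if s: "s \<in> {0..T}" for s
  proof -
    define w where "w = \<Gamma> s \<omega>"
    have w: "w \<in> \<Omega>" using \<Gamma>_mem[OF s] by (simp add: w_def)

    \<comment> \<open>The path moves from \<open>w\<close> to \<open>\<Gamma> v \<omega>\<close>
      while time and space sit at \<open>v\<close> and \<open>x v\<close>; the derivative is
      nevertheless taken at \<open>(s, x s, w)\<close>.\<close>
    have path: "(\<lambda>v. \<Phi> v - F v (x v) w - blinfun_apply (DF s (x s) w) (\<Gamma>' s \<omega>) * (v - s))
        \<in> o[at s within {0..T}](\<lambda>v. v - s)"
    proof -
      have F_cont: "continuous_on {0..T} (\<lambda>v. F v (x v) (w + blinfun_apply j k))" for k
      proof -
        have m: "w + blinfun_apply j k \<in> \<Omega>" by (rule add_mem[OF w])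
        obtain L where L: "\<And>v. v \<in> {0..T} \<Longrightarrow> L-lipschitz_on UNIV (\<lambda>y. F v y (w + blinfun_apply j k))"
          using F_lipschitz[OF m] by blast
        have "continuous_on {0..T} (\<lambda>v. F v y (w + blinfun_apply j k))" for y
          using F_holder[OF m] \<alpha>_pos holder_on_imp_continuous_on by blast
        from lipschitz_compose_continuous_on[OF this L x_cont] show ?thesis .
      qed
      from H_derivative_along_curve[OF DF_uniform[OF w] x_cont F_cont c_cont c'[OF s] s]
      show ?thesis
      proof (rule landau_o.small.in_cong[THEN iffD1, rotated])
        have "F v (x v) (w + blinfun_apply j (c v - c s)) = \<Phi> v" if "v \<in> {0..T}" for v
          by (simp add: \<Phi>_def w_def flip: c[OF that s])
        then show "\<forall>\<^sub>F v in at s within {0..T}. F v (x v) (w + blinfun_apply j (c v - c s)) - F v (x v) w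
            - blinfun_apply (DF s (x s) w) (\<Gamma>' s \<omega>) * (v - s)
          = \<Phi> v - F v (x v) w - blinfun_apply (DF s (x s) w) (\<Gamma>' s \<omega>) * (v - s)"
          by (simp add: eventually_at_filter)
      qed
    qed

    define E where "E v = f0 s (x s) w * (v - s) + f1 s (x s) w * (apply_bcontfun w v - apply_bcontfun w s)" for v
    have time: "(\<lambda>v. F v (x s) w - F s (x s) w - E v) \<in> o[at s within {0..T}](\<lambda>v. v - s)"
    proof -
      obtain \<alpha> where \<alpha>: "1 - H < \<alpha>" "holder_on \<alpha> {0..T} (\<lambda>v. f1 v (x s) w)"
        using f1_holder[OF w] by blast
      obtain \<beta> where \<beta>: "1/2 < \<beta>" "\<beta> < H" "1 < \<alpha> + \<beta>"
        using exponent[OF \<alpha>(1)] by blast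
      have "0 < \<beta>" using \<beta> by simp
      then show ?thesis
        unfolding E_def
        by (intro primitive_germ[OF F_eq[OF _ w] f0_cont[OF w] \<alpha>(2) holder[OF w _ \<beta>(2)] \<alpha>_pos[OF \<alpha>(1)] _ \<beta>(3) s])
    qed

    have space: "(\<lambda>v. F v (x v) w - F s (x s) w - E v - Fx s (x s) w * D s v)
        \<in> o[at s within {0..T}](\<lambda>v. v - s)"
    proof -
      obtain \<alpha> where \<alpha>: "1 - H < \<alpha>" "holder_on \<alpha> {0..T} (\<lambda>v. Fx v (x s) w)"
        using Fx_holder[OF w] by blast
      obtain \<beta> where \<beta>: "1/2 < \<beta>" "\<beta> < H" "1 < \<alpha> + \<beta>"
        using exponent[OF \<alpha>(1)] by blast
      obtain L where L: "\<And>v. v \<in> {0..T} \<Longrightarrow> L-lipschitz_on UNIV (\<lambda>y. Fx v y w)"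
        using Fx_lipschitz[OF w] by blast
      show ?thesis
        using \<beta> by (intro chain_germ[where F = "\<lambda>v y. F v y w" and Fx = "\<lambda>v y. Fx v y w",
              OF s Fx[OF _ w] L \<alpha>(2) \<beta>(1,3) x_bigo[OF s] x_germ[OF s] time]) auto
    qed

    \<comment> \<open>\<open>w\<close> differs from \<open>B\<close> by the primitive of
      \<open>h s\<close>, whose derivative at \<open>s\<close> is \<open>h s s \<omega>\<close>.
      This is the origin of the term with \<open>f1\<close> and \<open>h\<close> in the
      formula.\<close>
    have shift: "(\<lambda>v. f1 s (x s) w * (apply_bcontfun w v - apply_bcontfun w s - (B v - B s) - h s s \<omega> * (v - s)))
        \<in> o[at s within {0..T}](\<lambda>v. v - s)"
    proof -
      have "(\<lambda>v. integral {0..v} (\<lambda>u. h s u \<omega>) - integral {0..s} (\<lambda>u. h s u \<omega>) - h s s \<omega> * (v - s))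
          \<in> o[at s within {0..T}](\<lambda>v. v - s)"
        by (intro has_real_derivative_smallo integral_has_real_derivative h_cont_u s \<omega>)
      then have "(\<lambda>v. apply_bcontfun w v - apply_bcontfun w s - (B v - B s) - h s s \<omega> * (v - s))
          \<in> o[at s within {0..T}](\<lambda>v. v - s)"
      proof (rule landau_o.small.in_cong[THEN iffD1, rotated])
        have "apply_bcontfun w v = B v + integral {0..v} (\<lambda>u. h s u \<omega>)" if "v \<in> {0..T}" for v
          unfolding w_def B_def by (rule \<Gamma>_eq[OF s that \<omega>])
        then show "\<forall>\<^sub>F v in at s within {0..T}.
            integral {0..v} (\<lambda>u. h s u \<omega>) - integral {0..s} (\<lambda>u. h s u \<omega>) - h s s \<omega> * (v - s)
          = apply_bcontfun w v - apply_bcontfun w s - (B v - B s) - h s s \<omega> * (v - s)"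
          using s by (simp add: eventually_at_filter)
      qed
      then show ?thesis by simp
    qed

    \<comment> \<open>The intermediate values \<open>F v (x v) w\<close> and the increments of
      \<open>w\<close> cancel in the sum.\<close>
    from sum_in_smallo(1)[OF path sum_in_smallo(1)[OF space shift]]
    show ?thesis
    proof (rule landau_o.small.in_cong[THEN iffD1, rotated], intro always_eventually allI)
      fix v
      show "\<Phi> v - F v (x v) w - blinfun_apply (DF s (x s) w) (\<Gamma>' s \<omega>) * (v - s)
          + (F v (x v) w - F s (x s) w - E v - Fx s (x s) w * D s v
          + f1 s (x s) w * (apply_bcontfun w v - apply_bcontfun w s - (B v - B s) - h s s \<omega> * (v - s)))
        = \<Phi> v - \<Phi> s - A s * (v - s) - M s * (B v - B s)"
        by (simp add: A_def M_def E_def D_def \<Phi>_def[of s] flip: w_def) (simp add: algebra_simps)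
    qed
  qed

  \<comment> \<open>Integration of the expansion over \<open>[0, t]\<close>\<close>
  have sub: "{0..t} \<subseteq> {0..T}" using t by auto
  have "has_rs_integral M B 0 t
      (rs_integral (\<lambda>s. f1 s (x s) (\<Gamma> s \<omega>)) B 0 t + rs_integral (\<lambda>s. Fx s (x s) (\<Gamma> s \<omega>) * g1 s \<omega>) B 0 t)"
    (is "has_rs_integral _ _ _ _ ?J")
    unfolding M_def using int_f1 int_Fx_g1
    by (intro has_rs_integral_add has_rs_integral_rs_integral) (simp_all add: x_def B_def)
  then have A: "(A has_integral \<Phi> t - \<Phi> 0 - ?J) {0..t}"
  proof (rule has_integral_of_germ[rotated 2])
    show "(\<lambda>v. \<Phi> v - \<Phi> s - A s * (v - s) - M s * (B v - B s)) \<in> o[at s within {0..t}](\<lambda>v. v - s)"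
      if "s \<in> {0..t}" for s
      using germ[of s] that sub by (intro landau_o.small.filter_mono[OF at_le[OF sub]]) auto
  qed (use t in simp)
  \<comment> \<open>Removing the three \<open>ds\<close> integrands already known to be integrable
    from \<open>A\<close> leaves the derivative along \<open>\<Gamma>'\<close>, and so yields both
    its integrability and its integral.\<close>
  have "((\<lambda>s. A s - f0 s (x s) (\<Gamma> s \<omega>) - f1 s (x s) (\<Gamma> s \<omega>) * h s s \<omega> - Fx s (x s) (\<Gamma> s \<omega>) * g0 s \<omega>)
      has_integral \<Phi> t - \<Phi> 0 - ?J - integral {0..t} (\<lambda>s. f0 s (x s) (\<Gamma> s \<omega>))
        - integral {0..t} (\<lambda>s. f1 s (x s) (\<Gamma> s \<omega>) * h s s \<omega>)
        - integral {0..t} (\<lambda>s. Fx s (x s) (\<Gamma> s \<omega>) * g0 s \<omega>)) {0..t}"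
    using int_f0 int_f1h int_Fx_g0 unfolding x_def[symmetric]
    by (intro has_integral_diff A integrable_integral)
  then have DF_int: "((\<lambda>s. blinfun_apply (DF s (x s) (\<Gamma> s \<omega>)) (\<Gamma>' s \<omega>))
      has_integral \<Phi> t - \<Phi> 0 - ?J - integral {0..t} (\<lambda>s. f0 s (x s) (\<Gamma> s \<omega>))
        - integral {0..t} (\<lambda>s. f1 s (x s) (\<Gamma> s \<omega>) * h s s \<omega>)
        - integral {0..t} (\<lambda>s. Fx s (x s) (\<Gamma> s \<omega>) * g0 s \<omega>)) {0..t}"
    by (simp add: A_def)
  show ?thesis
    using has_integral_integrable[OF DF_int] integral_unique[OF DF_int]
    unfolding \<Phi>_def x_def B_def by simp
qed

end
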